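(* On any domain $\Omega\subset\mathbb{R}^n$ $(n\ge 3)$ we have $\mathcal{F}_\Omega\le\mathcal{M}_\Omega$, that is, $\mathcal{F}_\Omega(\mathbf{x},\Lambda)\le\mathcal{M}_\Omega(\mathbf{x},\Lambda)$ for all $\mathbf{x}\in\Omega$ and $\Lambda\in G_2(\mathbb{R}^n)$.
   Context: A domain is a nonempty connected open set. $\mathbb{D}=\{z=x+iy\in\mathbb{C}:|z|<1\}$. A $C^1$ map $f$ from an open subset of $\mathbb{R}^2=\mathbb{C}$ to $\mathbb{R}^n$ is conformal if $|f_x|=|f_y|$ and $f_x\cdot f_y=0$ at every point (it need not be an immersion). $\mathrm{CH}(\mathbb{D},\Omega)$ denotes the set of all conformal harmonic maps $\mathbb{D}\to\Omega$. $G_2(\mathbb{R}^n)$ is the Grassmann manifold of $2$-dimensional linear subspaces of $\mathbb{R}^n$. For $\mathbf{x}\in\Omega$, $\Lambda\in G_2(\mathbb{R}^n)$, $$\mathcal{M}_\Omega(\mathbf{x},\Lambda)=\inf\{1/\|df_0\|: f\in\mathrm{CH}(\mathbb{D},\Omega),\ f(0)=\mathbf{x},\ df_0(\mathbb{R}^2)=\Lambda\},$$ where $\|df_0\|$ is the operator norm of the differential $df_0:\mathbb{R}^2\to\mathbb{R}^n$. An upper-semicontinuous function $u:\Omega\to[-\infty,+\infty)$ is minimal plurisubharmonic (MPSH) if for every affine $2$-plane $L\subset\mathbb{R}^n$ the restriction of $u$ to $L\cap\Omega$ is subharmonic in conformal linear coordinates on $L$ (the value $-\infty$ identically is allowed).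 For $u$ of class $C^2$ near $\mathbf{x}$, $\mathrm{tr}_\Lambda\mathrm{Hess}_u(\mathbf{x})$ denotes the trace of the restriction to $\Lambda$ of the Hessian quadratic form of $u$ at $\mathbf{x}$. Define $$\mathcal{F}_\Omega(\mathbf{x},\Lambda)=\frac12\sup_u\sqrt{\mathrm{tr}_\Lambda\mathrm{Hess}_u(\mathbf{x})},$$ where the supremum is over all MPSH functions $u:\Omega\to[0,1]$ which are of class $C^2$ near $\mathbf{x}$ such that $u(\mathbf{x})=0$ and $\log u$ is MPSH on $\Omega$. If there are no such functions other than $u=0$, we set $\mathcal{F}_\Omega(\mathbf{x},\Lambda)=0$. *)

theory Defs
  imports "HOL-Analysis.Analysis"
begin

definition dderiv :: "('a::real_normed_vector \<Rightarrow> 'b::real_normed_vector) \<Rightarrow> 'a \<Rightarrow> 'a \<Rightarrow> 'b"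
  where "dderiv f v x = frechet_derivative f (at x) v"

text \<open>On open subsets of a finite-dimensional space, the following two predicates are the usual
  notions of class \<open>C\<^sup>1\<close> and \<open>C\<^sup>2\<close> (directional derivatives in all directions
  amount to the partial derivatives).\<close>

definition C1_on :: "('a::euclidean_space \<Rightarrow> 'b::real_normed_vector) \<Rightarrow> 'a set \<Rightarrow> bool"
  where "C1_on f S \<longleftrightarrow> (\<forall>x\<in>S. f differentiable at x) \<and> (\<forall>v. continuous_on S (dderiv f v))"

definition C2_on :: "('a::euclidean_space \<Rightarrow> 'b::real_normed_vector) \<Rightarrow> 'a set \<Rightarrow> bool"
  where "C2_on f S \<longleftrightarrow> C1_on f S \<and> (\<forall>v. C1_on (dderiv f v) S)"

definition harmonic_map_on :: "(complex \<Rightarrow> 'a::real_normed_vector) \<Rightarrow> complex set \<Rightarrow> bool"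
  where "harmonic_map_on f S \<longleftrightarrow>
    C2_on f S \<and> (\<forall>z\<in>S. dderiv (dderiv f 1) 1 z + dderiv (dderiv f \<i>) \<i> z = 0)"

definition conformal_map_on :: "(complex \<Rightarrow> 'a::real_inner) \<Rightarrow> complex set \<Rightarrow> bool"
  where "conformal_map_on f S \<longleftrightarrow> C1_on f S \<and>
    (\<forall>z\<in>S. norm (dderiv f 1 z) = norm (dderiv f \<i> z) \<and> dderiv f 1 z \<bullet> dderiv f \<i> z = 0)"

definition CH :: "complex set \<Rightarrow> 'a::euclidean_space set \<Rightarrow> (complex \<Rightarrow> 'a) set"
  where "CH D \<Omega> = {f. f ` D \<subseteq> \<Omega> \<and> conformal_map_on f D \<and> harmonic_map_on f D}"

definition Grass2 :: "'a::euclidean_space set set"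
  where "Grass2 = {\<Lambda>. subspace \<Lambda> \<and> dim \<Lambda> = 2}"

definition M_metric :: "'a::euclidean_space set \<Rightarrow> 'a \<Rightarrow> 'a set \<Rightarrow> ereal"
  where "M_metric \<Omega> x \<Lambda> =
    Inf {ereal (1 / onorm (frechet_derivative f (at 0))) | f.
          f \<in> CH (ball 0 1) \<Omega> \<and> f 0 = x \<and> range (frechet_derivative f (at 0)) = \<Lambda>}"

definition usc_on :: "'a::topological_space set \<Rightarrow> ('a \<Rightarrow> ereal) \<Rightarrow> bool"
  where "usc_on S u \<longleftrightarrow> (\<forall>x\<in>S. u x < \<infinity>) \<and> (\<forall>c. openin (top_of_set S) {x\<in>S. u x < c})"

text \<open>Mean value over the circle with centre \<open>a\<close> and radius \<open>r\<close>. The function \<open>e2ennreal\<close> takes the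
  positive part. For an upper semicontinuous function below \<open>\<infinity>\<close> on the circle the first integral
  is finite, so that the difference is a number in \<open>[-\<infinity>,\<infinity>)\<close>.\<close>

definition circle_mean :: "(complex \<Rightarrow> ereal) \<Rightarrow> complex \<Rightarrow> real \<Rightarrow> ereal"
  where "circle_mean u a r = ereal (1 / (2 * pi)) *
    (enn2ereal (\<integral>\<^sup>+t\<in>{0..2*pi}. e2ennreal (u (a + of_real r * cis t)) \<partial>lborel) -
     enn2ereal (\<integral>\<^sup>+t\<in>{0..2*pi}. e2ennreal (- u (a + of_real r * cis t)) \<partial>lborel))"

definition subharmonic_on :: "complex set \<Rightarrow> (complex \<Rightarrow> ereal) \<Rightarrow> bool"
  where "subharmonic_on U u \<longleftrightarrow>
    usc_on U u \<and> (\<forall>a r. 0 < r \<longrightarrow> cball a r \<subseteq> U \<longrightarrow> u a \<le> circle_mean u a r)"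

definition conformal_linear_coords :: "(complex \<Rightarrow> 'a::euclidean_space) \<Rightarrow> 'a set \<Rightarrow> bool"
  where "conformal_linear_coords \<phi> L \<longleftrightarrow> range \<phi> = L \<and>
    (\<exists>p v w. v \<noteq> 0 \<and> norm v = norm w \<and> v \<bullet> w = 0 \<and>
      \<phi> = (\<lambda>z. p + Re z *\<^sub>R v + Im z *\<^sub>R w))"

definition mpsh_on :: "'a::euclidean_space set \<Rightarrow> ('a \<Rightarrow> ereal) \<Rightarrow> bool"
  where "mpsh_on \<Omega> u \<longleftrightarrow> usc_on \<Omega> u \<and>
    (\<forall>L \<phi>. affine L \<longrightarrow> aff_dim L = 2 \<longrightarrow> conformal_linear_coords \<phi> L \<longrightarrow>
      subharmonic_on (\<phi> -` \<Omega>) (u \<circ> \<phi>))"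

definition Hess :: "('a::euclidean_space \<Rightarrow> real) \<Rightarrow> 'a \<Rightarrow> 'a \<Rightarrow> real"
  where "Hess u x v = dderiv (dderiv u v) v x"

text \<open>The trace of the restriction of a quadratic form \<open>q\<close> to a subspace; it does not depend on
  the orthonormal basis chosen.\<close>

definition trace_on :: "'a::euclidean_space set \<Rightarrow> ('a \<Rightarrow> real) \<Rightarrow> real"
  where "trace_on \<Lambda> q =
    (\<Sum>b\<in>(SOME B. pairwise orthogonal B \<and> (\<forall>b\<in>B. norm b = 1) \<and> span B = \<Lambda>). q b)"

definition elog :: "real \<Rightarrow> ereal"
  where "elog t = (if t = 0 then -\<infinity> else ereal (ln t))"

definition F_class :: "'a::euclidean_space set \<Rightarrow> 'a \<Rightarrow> ('a \<Rightarrow> real) set"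
  where "F_class \<Omega> x = {u. (\<forall>y\<in>\<Omega>. 0 \<le> u y \<and> u y \<le> 1) \<and>
    mpsh_on \<Omega> (\<lambda>y. ereal (u y)) \<and>
    (\<exists>U. open U \<and> x \<in> U \<and> U \<subseteq> \<Omega> \<and> C2_on u U) \<and>
    u x = 0 \<and> mpsh_on \<Omega> (\<lambda>y. elog (u y))}"

definition F_metric :: "'a::euclidean_space set \<Rightarrow> 'a \<Rightarrow> 'a set \<Rightarrow> ereal"
  where "F_metric \<Omega> x \<Lambda> =
    (if \<forall>u\<in>F_class \<Omega> x. \<forall>y\<in>\<Omega>. u y = 0 then 0
     else ereal (1 / 2) * (SUP u\<in>F_class \<Omega> x. ereal (sqrt (trace_on \<Lambda> (Hess u x)))))"

end

theory Submission
  imports Defs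
begin

text \<open>
  Let \<open>f\<close> be a conformal harmonic disc with \<open>f 0 = x\<close> and \<open>u\<close> a competitor for \<open>\<F>\<close>. Both \<open>u \<circ> f\<close>
  and \<open>log (u \<circ> f)\<close> behave like subharmonic functions, and \<open>u \<circ> f\<close> vanishes to second order at \<open>0\<close>,
  so the maximum principle applied to \<open>log (u (f z)) - 2 log \<bar>z\<bar>\<close> gives \<open>u (f z) \<le> \<bar>z\<bar>\<^sup>2\<close>. Comparing
  second-order terms at \<open>0\<close> bounds the Hessian of \<open>u\<close> on the image of \<open>df\<^sub>0\<close>.

  Since \<open>u\<close> is only upper semicontinuous away from \<open>x\<close>, the maximum principle along \<open>f\<close> is not
  obtained from smoothing \<open>u\<close>. Instead the variables are doubled: one maximises
  \<open>log (u y) - h z - P \<bar>y - f z\<bar>\<^sup>2\<close> over pairs \<open>(y, z)\<close> with a strictly superharmonic \<open>h\<close>. At an interior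
  maximum one moves \<open>(y, z)\<close> to \<open>(y + df\<^sub>z \<zeta>, z + \<zeta>)\<close>. Conformality places \<open>y + df\<^sub>z \<zeta>\<close> on a plane on which the
  sub-mean value inequality for \<open>log u\<close> is available, and harmonicity of \<open>f\<close> makes the penalty term
  change by \<open>o(\<bar>\<zeta>\<bar>\<^sup>2)\<close> on average over circles, which contradicts \<open>\<Delta>h < 0\<close>.
\<close>

section \<open>Directional derivatives and the second-order Taylor expansion\<close>

lemma has_derivative_dderiv:
  "f differentiable at x \<Longrightarrow> (f has_derivative (\<lambda>v. dderiv f v x)) (at x)"
  unfolding dderiv_def by (simp add: frechet_derivative_works)

lemma dderiv_eqI: "(f has_derivative f') (at x) \<Longrightarrow> dderiv f v x = f' v"
  unfolding dderiv_def using frechet_derivative_at by metis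

lemma linear_dderiv: "f differentiable at x \<Longrightarrow> linear (\<lambda>v. dderiv f v x)"
  using has_derivative_dderiv has_derivative_linear by blast

lemma C2_on_differentiable:
  assumes "C2_on f S" "x \<in> S"
  shows "f differentiable at x" "dderiv f v differentiable at x"
  using assms unfolding C2_on_def C1_on_def by auto

text \<open>Linearity in \<open>w\<close> is that of a differential. Linearity in \<open>v\<close>
  holds for \<open>dderiv f v\<close> at every point of the open set \<open>S\<close>, so it can be
  differentiated as an identity of functions near \<open>x\<close>.\<close>

lemma bilinear_dderiv2:
  fixes f :: "'a::euclidean_space \<Rightarrow> 'b::real_normed_vector"
  assumes "C2_on f S" "open S" "x \<in> S"
  shows "bilinear (\<lambda>v w. dderiv (dderiv f v) w x)"
proof -
  note d = C2_on_differentiable[OF assms(1)]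
  have add: "dderiv (dderiv f (a + b)) w x = dderiv (dderiv f a) w x + dderiv (dderiv f b) w x" for a b w
  proof (rule dderiv_eqI, rule has_derivative_transform_within_open)
    show "((\<lambda>y. dderiv f a y + dderiv f b y) has_derivative
        (\<lambda>w. dderiv (dderiv f a) w x + dderiv (dderiv f b) w x)) (at x)"
      by (intro has_derivative_add has_derivative_dderiv d assms)
  qed (use assms linear_add[OF linear_dderiv[OF d(1)]] in auto)
  have scale: "dderiv (dderiv f (c *\<^sub>R a)) w x = c *\<^sub>R dderiv (dderiv f a) w x" for c a w
  proof (rule dderiv_eqI, rule has_derivative_transform_within_open)
    show "((\<lambda>y. c *\<^sub>R dderiv f a y) has_derivative (\<lambda>w. c *\<^sub>R dderiv (dderiv f a) w x)) (at x)"
      by (intro has_derivative_scaleR_right has_derivative_dderiv d assms)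
  qed (use assms linear_scale[OF linear_dderiv[OF d(1)]] in auto)
  show ?thesis
    unfolding bilinear_def
    by (auto intro!: linearI simp: add scale linear_dderiv[OF d(2)[OF assms(3)], THEN linear_add]
      linear_dderiv[OF d(2)[OF assms(3)], THEN linear_scale])
qed

text \<open>Subtract the quadratic polynomial in \<open>t\<close> from
  \<open>f (x + t *\<^sub>R k)\<close>. The derivative of the difference is the first-order error of
  \<open>dderiv f k\<close>, and the mean value inequality on [0,1] turns its bound into one for the
  remainder.\<close>

lemma C2_on_taylor:
  fixes f :: "'a::euclidean_space \<Rightarrow> 'b::real_normed_vector"
  assumes "C2_on f S" "open S" "x \<in> S"
  shows "((\<lambda>k. (f (x + k) - f x - dderiv f k x - (1/2) *\<^sub>R dderiv (dderiv f k) k x) /\<^sub>R (norm k)\<^sup>2)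
    \<longlongrightarrow> 0) (at 0)"
proof -
  note d = C2_on_differentiable[OF assms(1)]
  let ?T = "\<lambda>k. f (x + k) - f x - dderiv f k x - (1/2) *\<^sub>R dderiv (dderiv f k) k x"
  note bil = bilinear_dderiv2[OF assms]
  have bound: "\<exists>e>0. \<forall>k. norm k < e \<longrightarrow> norm (?T k) \<le> (\<epsilon> * DIM('a)) * (norm k)\<^sup>2"
    if "\<epsilon> > 0" for \<epsilon> :: real
  proof -
    obtain e0 where e0: "e0 > 0" "ball x e0 \<subseteq> S"
      using assms openE by blast
    \<comment> \<open>First-order estimates are taken for the finitely many basis directions only.
      Expanding \<open>k\<close> in \<open>Basis\<close> then gives one radius for all
      \<open>k\<close>, at the price of the factor \<open>DIM('a)\<close>.\<close>
    have "\<exists>e>0. \<forall>k. norm k < e \<longrightarrow> norm (dderiv f b (x + k) - dderiv f b x - dderiv (dderiv f b) k x)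
        \<le> \<epsilon> * norm k" for b
    proof -
      obtain e where "e > 0" "\<And>y. norm (y - x) < e \<Longrightarrow> norm (dderiv f b y - dderiv f b x -
          dderiv (dderiv f b) (y - x) x) \<le> \<epsilon> * norm (y - x)"
        using has_derivative_dderiv[OF d(2)[OF assms(3), of b]] \<open>\<epsilon> > 0\<close>
        unfolding has_derivative_at_alt by meson
      then show ?thesis
        by (intro exI[of _ e]) (metis add_diff_cancel_left')
    qed
    then obtain e where e: "\<And>b. e b > 0" "\<And>b k. norm k < e b \<Longrightarrow>
        norm (dderiv f b (x + k) - dderiv f b x - dderiv (dderiv f b) k x) \<le> \<epsilon> * norm k"
      by metis
    define r where "r = min e0 (Min (e ` Basis))"
    have "r > 0" and r: "r \<le> e0" "\<And>b. b \<in> Basis \<Longrightarrow> r \<le> e b"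
      using e0 e by (auto simp: r_def min.coboundedI2)
    have "norm (?T k) \<le> (\<epsilon> * DIM('a)) * (norm k)\<^sup>2" if k: "norm k < r" for k
    proof -
      let ?g = "\<lambda>t. f (x + t *\<^sub>R k) - t *\<^sub>R dderiv f k x - (t\<^sup>2 / 2) *\<^sub>R dderiv (dderiv f k) k x"
      let ?g' = "\<lambda>t. dderiv f k (x + t *\<^sub>R k) - dderiv f k x - t *\<^sub>R dderiv (dderiv f k) k x"
      have tk: "norm (t *\<^sub>R k) \<le> norm k" if "t \<in> {0..1}" for t
        using that by (auto intro: mult_left_le_one_le)
      have inS: "x + t *\<^sub>R k \<in> S" if "t \<in> {0..1}" for t
        using e0 r k tk[OF that] by (auto simp: dist_norm subset_iff)
      have der: "(?g has_derivative (\<lambda>s. s *\<^sub>R ?g' t)) (at t within {0..1})" if "t \<in> {0..1}" for t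
      proof -
        have "((\<lambda>t. f (x + t *\<^sub>R k)) has_derivative (\<lambda>s. dderiv f (s *\<^sub>R k) (x + t *\<^sub>R k)))
            (at t within {0..1})"
          by (rule has_derivative_compose[where f = "\<lambda>t. x + t *\<^sub>R k" and g = f, OF _ has_derivative_dderiv[OF d(1)[OF inS[OF that]]]])
            (auto intro!: derivative_eq_intros)
        then show ?thesis
          by (auto intro!: derivative_eq_intros simp: algebra_simps
            linear_dderiv[OF d(1)[OF inS[OF that]], THEN linear_scale])
      qed
      have "norm (?g' t) \<le> (\<epsilon> * DIM('a)) * (norm k)\<^sup>2" if t: "t \<in> {0..1}" for t
      proof -
        let ?E = "\<lambda>b. dderiv f b (x + t *\<^sub>R k) - dderiv f b x - dderiv (dderiv f b) (t *\<^sub>R k) x"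
        have D: "dderiv f k y = (\<Sum>b\<in>Basis. (k \<bullet> b) *\<^sub>R dderiv f b y)" if "y \<in> S" for y
          using linear_sum[OF linear_dderiv[OF d(1)[OF that]], of "\<lambda>b. (k \<bullet> b) *\<^sub>R b" Basis]
            linear_scale[OF linear_dderiv[OF d(1)[OF that]]]
          by (simp add: euclidean_representation)
        have lin1: "linear (\<lambda>v. dderiv (dderiv f v) w x)" for w
          using bil unfolding bilinear_def by auto
        have D2: "t *\<^sub>R dderiv (dderiv f k) k x = (\<Sum>b\<in>Basis. (k \<bullet> b) *\<^sub>R dderiv (dderiv f b) (t *\<^sub>R k) x)"
          using linear_sum[OF lin1, of "\<lambda>b. (k \<bullet> b) *\<^sub>R b" Basis] linear_scale[OF lin1]
            linear_scale[OF linear_dderiv[OF d(2)[OF assms(3)]]]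
          by (simp add: euclidean_representation scaleR_sum_right mult.commute)
        have "?g' t = (\<Sum>b\<in>Basis. (k \<bullet> b) *\<^sub>R ?E b)"
          unfolding D2 D[OF inS[OF t]] D[OF assms(3)]
          by (simp add: sum_subtractf scaleR_diff_right)
        also have "norm \<dots> \<le> (\<Sum>b\<in>(Basis::'a set). norm k * (\<epsilon> * norm k))"
        proof (rule sum_norm_le)
          fix b :: 'a assume b: "b \<in> Basis"
          have "norm (?E b) \<le> \<epsilon> * norm (t *\<^sub>R k)"
            using e(2)[of "t *\<^sub>R k" b] tk[OF t] r(2)[OF b] k by auto
          also have "\<dots> \<le> \<epsilon> * norm k"
            using tk[OF t] \<open>\<epsilon> > 0\<close> by simp
          finally show "norm ((k \<bullet> b) *\<^sub>R ?E b) \<le> norm k * (\<epsilon> * norm k)"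
            unfolding norm_scaleR using Basis_le_norm[OF b, of k] by (intro mult_mono) auto
        qed
        finally show ?thesis by (simp add: power2_eq_square algebra_simps)
      qed
      then have "norm (?g 1 - ?g 0) \<le> (\<epsilon> * DIM('a)) * (norm k)\<^sup>2 * norm (1 - 0 :: real)"
        by (intro differentiable_bound[OF convex_real_interval(5) der])
          (auto intro!: onorm_le simp: mult.commute mult_left_mono)
      then show ?thesis by (simp add: algebra_simps)
    qed
    then show ?thesis using \<open>r > 0\<close> by blast
  qed
  show ?thesis
  proof (rule LIM_I)
    fix c :: real assume "c > 0"
    define \<epsilon> where "\<epsilon> = c / (2 * DIM('a))"
    have \<epsilon>: "\<epsilon> > 0" "\<epsilon> * DIM('a) < c"
      using \<open>c > 0\<close> by (auto simp: \<epsilon>_def field_simps)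
    obtain e where e: "e > 0" "\<And>k. norm k < e \<Longrightarrow> norm (?T k) \<le> (\<epsilon> * DIM('a)) * (norm k)\<^sup>2"
      using bound[OF \<epsilon>(1)] by blast
    have "norm (?T k /\<^sub>R (norm k)\<^sup>2 - 0) < c" if "k \<noteq> 0" "norm (k - 0) < e" for k
    proof -
      have "norm (?T k) \<le> (\<epsilon> * DIM('a)) * (norm k)\<^sup>2" using e that by auto
      also have "\<dots> < c * (norm k)\<^sup>2" using \<epsilon> that by (intro mult_strict_right_mono) auto
      finally show ?thesis using that by (simp add: norm_scaleR divide_inverse[symmetric] pos_divide_less_eq
            mult.commute[of "inverse _"] del: scaleR_diff_right)
    qed
    then show "\<exists>s>0. \<forall>k. k \<noteq> 0 \<and> norm (k - 0) < s \<longrightarrow> norm (?T k /\<^sub>R (norm k)\<^sup>2 - 0) < c"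
      using \<open>e > 0\<close> by blast
  qed
qed

section \<open>Upper semicontinuity, circle means and conformal planes\<close>

text \<open>Without a maximum, the relatively open sets where \<open>g x < c\<close>, with
  \<open>c\<close> a value of \<open>g\<close>, would cover \<open>S\<close>. The largest
  \<open>c\<close> of a finite subcover is attained at a point that lies in no member of the
  subcover.\<close>

lemma usc_attains_sup:
  fixes g :: "'a::topological_space \<Rightarrow> 'b::linorder"
  assumes "compact S" "S \<noteq> {}" and usc: "\<And>c. openin (top_of_set S) {x\<in>S. g x < c}"
  shows "\<exists>x\<in>S. \<forall>y\<in>S. g y \<le> g x"
proof (rule ccontr)
  assume "\<not> ?thesis"
  then have nomax: "\<exists>y\<in>S. g x < g y" if "x \<in> S" for x
    using that by (metis not_le)
  obtain V where V: "\<And>c. open (V c)" "\<And>c. {x\<in>S. g x < c} = S \<inter> V c"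
    using usc unfolding openin_open by metis
  have "S \<subseteq> (\<Union>c\<in>g ` S. V c)"
    using nomax V(2) by blast
  then obtain C where C: "C \<subseteq> g ` S" "finite C" "S \<subseteq> (\<Union>c\<in>C. V c)"
    using compactE_image[OF \<open>compact S\<close>, of "g ` S" V] V(1) by metis
  then have "C \<noteq> {}" using \<open>S \<noteq> {}\<close> by auto
  then obtain x where x: "x \<in> S" "g x = Max C"
    using C Max_in by (metis imageE subsetD)
  then obtain c where "c \<in> C" "g x < c"
    using C V(2) by blast
  then show False
    using x C Max_ge leD by metis
qed

text \<open>A real number strictly between \<open>U x\<close> and \<open>\<phi> x\<close> writes the
  set as a union of relatively open sets. This passes semicontinuity from \<open>u\<close> to
  \<open>u\<close> times a positive continuous factor.\<close>

lemma openin_less_continuous: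
  fixes U \<phi> :: "'a::topological_space \<Rightarrow> real"
  assumes usc: "\<And>c. openin (top_of_set S) {x\<in>S. U x < c}" and "continuous_on S \<phi>"
  shows "openin (top_of_set S) {x\<in>S. U x < \<phi> x}"
proof -
  have "{x\<in>S. U x < \<phi> x} = (\<Union>c. {x\<in>S. U x < c} \<inter> (S \<inter> \<phi> -` {c<..}))"
    by (auto intro: dense)
  moreover have "openin (top_of_set S) (S \<inter> \<phi> -` {c<..})" for c
    by (rule continuous_openin_preimage_gen[OF assms(2)]) auto
  ultimately show ?thesis
    using usc by (auto intro!: openin_Union)
qed

text \<open>The trigonometric majorant has mean \<open>w0 + (A + C) / 2\<close>: the terms with
  \<open>a\<close>, \<open>b\<close> and \<open>B\<close> average to zero, the squares to one half.
  Since \<open>w\<close> is nonpositive, the first integral in \<open>circle_mean\<close> vanishes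
  and only the second has to be bounded from below.\<close>

lemma circle_mean_less:
  fixes w0 a b A B C r :: real
  assumes neg: "\<And>t. w (of_real r * cis t) \<le> 0"
    and le: "\<And>t. w (of_real r * cis t) \<le> ereal (w0 + a * cos t + b * sin t +
      A * (cos t)\<^sup>2 + B * (cos t * sin t) + C * (sin t)\<^sup>2)"
    and "A + C < 0"
  shows "circle_mean w 0 r < ereal w0"
proof -
  define q where "q t = w0 + a * cos t + b * sin t +
      A * (cos t)\<^sup>2 + B * (cos t * sin t) + C * (sin t)\<^sup>2" for t
  \<comment> \<open>\<open>Q\<close> is an antiderivative of \<open>q\<close>.\<close>
  define Q where "Q t = w0 * t + a * sin t - b * cos t + A * (t + sin t * cos t) / 2
      + B * (sin t)\<^sup>2 / 2 + C * (t - sin t * cos t) / 2" for t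
  define I where "I = (\<integral>\<^sup>+t\<in>{0..2*pi}. e2ennreal (- w (of_real r * cis t)) \<partial>lborel)"
  have cont: "continuous_on UNIV q"
    unfolding q_def by (intro continuous_intros)
  have "(Q has_vector_derivative q t) (at t within {0..2*pi})" for t
  proof -
    have c: "(cos t)\<^sup>2 = 1 - (sin t)\<^sup>2" by (simp add: cos_squared_eq)
    have "(Q has_field_derivative (w0 + a * cos t + b * sin t + A * (1 + (cos t * cos t - sin t * sin t)) / 2
      + B * (2 * sin t * cos t) / 2 + C * (1 - (cos t * cos t - sin t * sin t)) / 2)) (at t within {0..2*pi})"
      unfolding Q_def by (auto intro!: derivative_eq_intros simp: field_simps)
    moreover have "w0 + a * cos t + b * sin t + A * (1 + (cos t * cos t - sin t * sin t)) / 2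
      + B * (2 * sin t * cos t) / 2 + C * (1 - (cos t * cos t - sin t * sin t)) / 2 = q t"
      unfolding q_def power2_eq_square[symmetric] c by (simp add: field_simps)
    ultimately show ?thesis
      by (simp add: has_real_derivative_iff_has_vector_derivative)
  qed
  then have "(q has_integral (Q (2*pi) - Q 0)) {0..2*pi}"
    by (intro fundamental_theorem_of_calculus) auto
  moreover have "Q (2*pi) - Q 0 = 2 * pi * w0 + pi * (A + C)"
    by (simp add: Q_def field_simps)
  ultimately have "((\<lambda>t. - q t) has_integral - (2 * pi * w0 + pi * (A + C))) {0..2*pi}"
    using has_integral_neg by metis
  moreover
  \<comment> \<open>The majorant \<open>q\<close> may be positive at some angles, so the comparison
    with a nonnegative integral goes through the positive part of \<open>- q\<close>, whose integral
    is at least that of \<open>- q\<close>.\<close>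
  have "(\<lambda>t. max 0 (- q t)) integrable_on {0..2*pi}"
    by (intro integrable_continuous_interval continuous_intros continuous_on_subset[OF cont]) auto
  then obtain J where J: "((\<lambda>t. max 0 (- q t)) has_integral J) {0..2*pi}"
    by (auto simp: integrable_on_def)
  ultimately have V: "- (2 * pi * w0 + pi * (A + C)) \<le> J"
    by (rule has_integral_le) auto
  have "0 \<le> J"
    using J by (rule has_integral_nonneg) auto
  have "ennreal J = (\<integral>\<^sup>+t. indicator {0..2*pi} t * max 0 (- q t) \<partial>lborel)"
    by (rule nn_integral_has_integral_lebesgue[OF _ J, symmetric]) auto
  also have "\<dots> \<le> I"
    unfolding I_def
  proof (rule nn_integral_mono)
    fix t :: real
    have "ereal (- q t) \<le> - w (of_real r * cis t)"
      using le[of t] unfolding q_def[symmetric] by (metis ereal_minus_le_minus uminus_ereal.simps(1))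
    then have "e2ennreal (ereal (- q t)) \<le> e2ennreal (- w (of_real r * cis t))"
      by (rule e2ennreal_mono)
    then show "ennreal (indicator {0..2*pi} t * max 0 (- q t))
      \<le> e2ennreal (- w (of_real r * cis t)) * indicator {0..2*pi} t"
      by (auto simp: e2ennreal_ereal max_def ennreal_neg split: split_indicator)
  qed
  finally have "enn2ereal (ennreal J) \<le> enn2ereal I"
    by (simp add: less_eq_ennreal.rep_eq)
  then have "ereal J \<le> enn2ereal I"
    using \<open>0 \<le> J\<close> by (simp add: enn2ereal_ennreal)
  then have I: "ereal (- (2 * pi * w0 + pi * (A + C))) \<le> enn2ereal I"
    using V by (meson ereal_less_eq(3) order_trans)
  have "e2ennreal (w (of_real r * cis t)) = 0" for t
    using neg[of t] by (simp add: e2ennreal_neg)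
  then have "circle_mean w 0 r = ereal (1 / (2 * pi)) * (0 - enn2ereal I)"
    unfolding circle_mean_def I_def by (simp add: zero_ennreal.rep_eq)
  also have "\<dots> \<le> ereal (1 / (2 * pi)) * (0 - ereal (- (2 * pi * w0 + pi * (A + C))))"
    by (intro ereal_mult_left_mono ereal_minus_mono I) auto
  also have "\<dots> = ereal (w0 + (A + C) / 2)"
    by (simp add: field_simps)
  also have "\<dots> < ereal w0" using assms(3) by simp
  finally show ?thesis .
qed

text \<open>Serves the points where the differential of the disc vanishes: there the translated
  point does not move and no plane is available.\<close>

lemma circle_mean_const:
  fixes c :: real
  assumes "c \<le> 0"
  shows "circle_mean (\<lambda>z. ereal c) a r = ereal c"
proof -
  have "(\<integral>\<^sup>+t\<in>{0..2*pi}. ennreal (- c) \<partial>lborel) = ennreal (- c * (2 * pi))"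
    using assms by (simp add: nn_integral_cmult_indicator ennreal_mult[symmetric] del: ennreal_mult'')
  then show ?thesis
    using assms unfolding circle_mean_def
    by (simp add: e2ennreal_ereal ennreal_neg enn2ereal_ennreal zero_ennreal.rep_eq mult_nonpos_nonneg)
qed

text \<open>Orthogonality makes the nonzero vectors \<open>v\<close> and \<open>w\<close>
  independent, so the range is a translate of a two-dimensional span. The three conclusions are what
  \<open>mpsh_on\<close> asks of a plane and its coordinates.\<close>

lemma conformal_plane:
  fixes p v w :: "'a::euclidean_space"
  assumes "v \<noteq> 0" "norm v = norm w" "v \<bullet> w = 0"
  defines "\<phi> \<equiv> \<lambda>z. p + Re z *\<^sub>R v + Im z *\<^sub>R w"
  shows "affine (range \<phi>)" "aff_dim (range \<phi>) = 2" "conformal_linear_coords \<phi> (range \<phi>)"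
proof -
  have r: "range \<phi> = (+) p ` span {v, w}"
  proof
    show "(+) p ` span {v, w} \<subseteq> range \<phi>"
    proof clarify
      fix y assume "y \<in> span {v, w}"
      then obtain a b where "y = a *\<^sub>R v + b *\<^sub>R w"
        by (auto simp: span_insert) (metis add_diff_cancel_left' diff_add_cancel)
      then have "p + y = \<phi> (Complex a b)" by (simp add: \<phi>_def)
      then show "p + y \<in> range \<phi>" by blast
    qed
    show "range \<phi> \<subseteq> (+) p ` span {v, w}"
    proof clarify
      fix z
      have "Re z *\<^sub>R v + Im z *\<^sub>R w \<in> span {v, w}"
        by (intro span_add span_mul span_base) auto
      then show "\<phi> z \<in> (+) p ` span {v, w}"
        unfolding \<phi>_def add.assoc by (rule imageI)
    qed
  qed
  have "w \<noteq> 0" "v \<noteq> w" using assms by auto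
  then have "independent {v, w}"
    using assms by (intro pairwise_orthogonal_independent)
      (auto simp: pairwise_def orthogonal_def inner_commute)
  then have "dim (span {v, w}) = 2"
    using \<open>v \<noteq> w\<close> by (simp add: dim_eq_card_independent)
  then show "aff_dim (range \<phi>) = 2"
    unfolding r aff_dim_translation_eq by (simp add: aff_dim_subspace)
  show "affine (range \<phi>)"
    unfolding r by (metis affine_translation subspace_imp_affine subspace_span)
  show "conformal_linear_coords \<phi> (range \<phi>)"
    unfolding conformal_linear_coords_def using assms by blast
qed

section \<open>The comparison principle along a conformal harmonic disc\<close>

text \<open>Maximality bounds \<open>ln (u (y0 + L \<zeta>))\<close> by \<open>ln (u y0)\<close>
  plus a linear part, a quadratic part of negative trace and a small error. By
  \<open>circle_mean_less\<close> the circle mean then drops below the central value, against the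
  sub-mean value inequality. The hypothesis \<open>max\<close> uses exponentials instead of
  logarithms so that it also makes sense at zeros of \<open>u\<close>.\<close>

lemma no_interior_max_penalised:
  fixes f :: "complex \<Rightarrow> 'a::euclidean_space" and h :: "complex \<Rightarrow> real" and u :: "'a \<Rightarrow> real"
  assumes mpsh: "mpsh_on \<Omega> (\<lambda>y. elog (u y))" and "open \<Omega>"
    and u01: "\<And>y. y \<in> \<Omega> \<Longrightarrow> 0 \<le> u y \<and> u y \<le> 1"
    and f: "conformal_map_on f D" "harmonic_map_on f D" and h: "C2_on h D" and D: "open D" "z0 \<in> D"
    and lap: "dderiv (dderiv h 1) 1 z0 + dderiv (dderiv h \<i>) \<i> z0 < 0"
    and y0: "y0 \<in> \<Omega>" "u y0 > 0"
    and max: "\<forall>\<^sub>F \<zeta> in at 0. u (y0 + dderiv f \<zeta> z0) *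
        exp (- h (z0 + \<zeta>) - P * (norm (y0 + dderiv f \<zeta> z0 - f (z0 + \<zeta>)))\<^sup>2)
      \<le> u y0 * exp (- h z0 - P * (norm (y0 - f z0))\<^sup>2)"
  shows False
proof -
  define L where "L \<zeta> = dderiv f \<zeta> z0" for \<zeta>
  define p where "p = y0 - f z0"
  define R where "R \<zeta> = f (z0 + \<zeta>) - f z0 - L \<zeta>" for \<zeta>
  define qf where "qf v w = dderiv (dderiv f v) w z0" for v w
  define qh where "qh v w = dderiv (dderiv h v) w z0" for v w
  \<comment> \<open>Half the Laplacian of \<open>h\<close> is \<open>- 4 * \<kappa>\<close>. Up to
    the square of the radius, bounding the error by \<open>\<kappa>\<close> adds
    \<open>2 * \<kappa>\<close> to the trace, which leaves \<open>- 2 * \<kappa>\<close>.\<close>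
  define \<kappa> where "\<kappa> = - (qh 1 1 + qh \<i> \<i>) / 8"
  have "\<kappa> > 0" using lap by (simp add: \<kappa>_def qh_def)
  have C2f: "C2_on f D" using f(2) by (simp add: harmonic_map_on_def)
  have bf: "bilinear qf" unfolding qf_def by (rule bilinear_dderiv2[OF C2f D])
  have bh: "bilinear qh" unfolding qh_def by (rule bilinear_dderiv2[OF h D])
  have df: "(f has_derivative L) (at z0)"
    unfolding L_def by (rule has_derivative_dderiv[OF C2_on_differentiable(1)[OF C2f D(2)]])
  have linL: "linear L" using df has_derivative_linear by blast
  have linh: "linear (\<lambda>\<zeta>. dderiv h \<zeta> z0)"
    by (rule linear_dderiv[OF C2_on_differentiable(1)[OF h D(2)]])
  txt \<open>The quadratic form \<open>p \<bullet> qf \<zeta> \<zeta>\<close> has trace zero because \<open>f\<close> is harmonic; it is split off from the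
    remainder \<open>E\<close> since it is not small but averages to zero over circles.\<close>
  define E where "E \<zeta> = h (z0 + \<zeta>) - h z0 - dderiv h \<zeta> z0 - (1/2) * qh \<zeta> \<zeta>
    + P * ((norm (y0 + L \<zeta> - f (z0 + \<zeta>)))\<^sup>2 - (norm p)\<^sup>2) + P * (p \<bullet> qf \<zeta> \<zeta>)" for \<zeta>
  have "((\<lambda>\<zeta>. E \<zeta> / (norm \<zeta>)\<^sup>2) \<longlongrightarrow> 0) (at 0)"
  proof -
    define Th where "Th \<zeta> = (h (z0 + \<zeta>) - h z0 - dderiv h \<zeta> z0 - (1/2) *\<^sub>R qh \<zeta> \<zeta>) /\<^sub>R (norm \<zeta>)\<^sup>2" for \<zeta>
    define Tf where "Tf \<zeta> = (f (z0 + \<zeta>) - f z0 - L \<zeta> - (1/2) *\<^sub>R qf \<zeta> \<zeta>) /\<^sub>R (norm \<zeta>)\<^sup>2" for \<zeta>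
    have lim: "(Th \<longlongrightarrow> 0) (at 0)" "(Tf \<longlongrightarrow> 0) (at 0)"
      unfolding Th_def Tf_def qf_def qh_def L_def
      by (rule C2_on_taylor[OF h D], rule C2_on_taylor[OF C2f D])
    \<comment> \<open>The penalty changes by \<open>- 2 * (p \<bullet> R \<zeta>)\<close>, which the
      second-order expansion of \<open>f\<close> controls, and by the squared norm of
      \<open>R \<zeta>\<close>, which is of smaller order by differentiability.\<close>
    have "((\<lambda>\<zeta>. norm (R \<zeta>) / norm \<zeta>) \<longlongrightarrow> 0) (at 0)"
      using df unfolding has_derivative_at R_def by simp
    then have "((\<lambda>\<zeta>. Th \<zeta> - 2 * P * (p \<bullet> Tf \<zeta>) + P * (norm (R \<zeta>) / norm \<zeta>)\<^sup>2) \<longlongrightarrow>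
        0 - 2 * P * (p \<bullet> 0) + P * 0\<^sup>2) (at 0)"
      by (intro tendsto_add tendsto_diff tendsto_mult tendsto_const tendsto_inner tendsto_power lim)
    moreover have "Th \<zeta> - 2 * P * (p \<bullet> Tf \<zeta>) + P * (norm (R \<zeta>) / norm \<zeta>)\<^sup>2 = E \<zeta> / (norm \<zeta>)\<^sup>2" for \<zeta>
    proof -
      have pR: "y0 + L \<zeta> - f (z0 + \<zeta>) = p - R \<zeta>" by (simp add: p_def R_def)
      have sq: "(norm (y0 + L \<zeta> - f (z0 + \<zeta>)))\<^sup>2 - (norm p)\<^sup>2 = (norm (R \<zeta>))\<^sup>2 - 2 * (p \<bullet> R \<zeta>)"
        unfolding pR power2_norm_eq_inner by (simp add: inner_diff_left inner_diff_right inner_commute[of "R \<zeta>" p])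
      have "p \<bullet> Tf \<zeta> = (p \<bullet> R \<zeta> - (1/2) * (p \<bullet> qf \<zeta> \<zeta>)) / (norm \<zeta>)\<^sup>2"
        by (simp only: Tf_def R_def inner_scaleR_right inner_diff_right divide_inverse mult.commute)
      moreover have "Th \<zeta> = (h (z0 + \<zeta>) - h z0 - dderiv h \<zeta> z0 - (1/2) * qh \<zeta> \<zeta>) / (norm \<zeta>)\<^sup>2"
        by (simp only: Th_def real_scaleR_def divide_inverse mult.commute)
      ultimately have "Th \<zeta> - 2 * P * (p \<bullet> Tf \<zeta>) + P * (norm (R \<zeta>) / norm \<zeta>)\<^sup>2 =
          (h (z0 + \<zeta>) - h z0 - dderiv h \<zeta> z0 - (1/2) * qh \<zeta> \<zeta>
            - 2 * P * (p \<bullet> R \<zeta> - (1/2) * (p \<bullet> qf \<zeta> \<zeta>)) + P * (norm (R \<zeta>))\<^sup>2) / (norm \<zeta>)\<^sup>2"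
        by (simp only: power_divide add_divide_distrib diff_divide_distrib right_diff_distrib times_divide_eq_right)
      also have "\<dots> = E \<zeta> / (norm \<zeta>)\<^sup>2"
        unfolding E_def sq by (simp add: algebra_simps)
      finally show ?thesis .
    qed
    ultimately show ?thesis by simp
  qed
  then have "\<forall>\<^sub>F \<zeta> in at 0. E \<zeta> / (norm \<zeta>)\<^sup>2 < \<kappa>"
    using \<open>\<kappa> > 0\<close> by (rule order_tendstoD)
  moreover have "(L \<longlongrightarrow> L 0) (at 0)"
    using has_derivative_bounded_linear[OF df] tendsto_ident_at by (rule bounded_linear.tendsto)
  then have "((\<lambda>\<zeta>. y0 + L \<zeta>) \<longlongrightarrow> y0 + 0) (at 0)"
    using linear_0[OF linL] by (intro tendsto_intros) auto
  then have "\<forall>\<^sub>F \<zeta> in at 0. y0 + L \<zeta> \<in> \<Omega>"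
    by (rule topological_tendstoD) (use assms in auto)
  ultimately have "\<forall>\<^sub>F \<zeta> in at 0. E \<zeta> / (norm \<zeta>)\<^sup>2 < \<kappa> \<and> y0 + L \<zeta> \<in> \<Omega> \<and>
      u (y0 + L \<zeta>) * exp (- h (z0 + \<zeta>) - P * (norm (y0 + L \<zeta> - f (z0 + \<zeta>)))\<^sup>2)
      \<le> u y0 * exp (- h z0 - P * (norm p)\<^sup>2)"
    using max unfolding L_def p_def by (simp add: eventually_conj_iff)
  then obtain d where d: "d > 0" "\<And>\<zeta>. \<zeta> \<noteq> 0 \<Longrightarrow> norm \<zeta> < d \<Longrightarrow> E \<zeta> / (norm \<zeta>)\<^sup>2 < \<kappa> \<and> y0 + L \<zeta> \<in> \<Omega> \<and>
      u (y0 + L \<zeta>) * exp (- h (z0 + \<zeta>) - P * (norm (y0 + L \<zeta> - f (z0 + \<zeta>)))\<^sup>2)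
      \<le> u y0 * exp (- h z0 - P * (norm p)\<^sup>2)"
    unfolding eventually_at by (auto simp: dist_norm)
  define r where "r = d / 2"
  have r: "0 < r" "r < d" using d by (auto simp: r_def)
  have Lexp: "L \<zeta> = Re \<zeta> *\<^sub>R L 1 + Im \<zeta> *\<^sub>R L \<i>" for \<zeta>
  proof -
    have "Re \<zeta> *\<^sub>R 1 + Im \<zeta> *\<^sub>R \<i> = \<zeta>" by (simp add: complex_eq_iff)
    then show ?thesis
      using linear_add[OF linL, of "Re \<zeta> *\<^sub>R 1" "Im \<zeta> *\<^sub>R \<i>"] by (simp add: linear_scale[OF linL])
  qed
  have conf: "norm (L 1) = norm (L \<i>)" "L 1 \<bullet> L \<i> = 0"
    using f(1) D(2) by (auto simp: conformal_map_on_def L_def)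
  let ?w = "\<lambda>\<zeta>. elog (u (y0 + L \<zeta>))"
  have elog_le: "elog (u y) \<le> 0" if "y \<in> \<Omega>" for y
    using u01[OF that] by (auto simp: elog_def)
  have "elog (u y0) \<le> circle_mean ?w 0 r"
  \<comment> \<open>If \<open>L 1\<close> vanishes, conformality makes \<open>L\<close> zero and the
    mean is that of a constant. Otherwise \<open>L 1\<close> and \<open>L \<i>\<close> are conformal
    coordinates on a plane through \<open>y0\<close>.\<close>
  proof (cases "L 1 = 0")
    case True
    then have "L \<zeta> = 0" for \<zeta> using conf Lexp[of \<zeta>] by simp
    moreover have "elog (u y0) = ereal (ln (u y0))" using y0 by (simp add: elog_def)
    ultimately show ?thesis
      using circle_mean_const[of "ln (u y0)" 0 r] elog_le[OF y0(1)] by simp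
  next
    case False
    define \<phi> where "\<phi> = (\<lambda>z. y0 + Re z *\<^sub>R L 1 + Im z *\<^sub>R L \<i>)"
    have \<phi>: "\<phi> \<zeta> = y0 + L \<zeta>" for \<zeta>
      by (simp add: \<phi>_def Lexp[of \<zeta>])
    have "subharmonic_on (\<phi> -` \<Omega>) ((\<lambda>y. elog (u y)) \<circ> \<phi>)"
      using mpsh conformal_plane[OF False conf, of y0] unfolding mpsh_on_def \<phi>_def by blast
    moreover have "cball 0 r \<subseteq> \<phi> -` \<Omega>"
    proof
      fix \<zeta> :: complex assume "\<zeta> \<in> cball 0 r"
      then show "\<zeta> \<in> \<phi> -` \<Omega>"
        using d(2)[of \<zeta>] y0(1) r linear_0[OF linL] by (cases "\<zeta> = 0") (auto simp: \<phi>)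
    qed
    ultimately have "elog (u (\<phi> 0)) \<le> circle_mean (\<lambda>\<zeta>. elog (u (\<phi> \<zeta>))) 0 r"
      using r by (simp add: subharmonic_on_def o_def)
    then show ?thesis using linear_0[OF linL] by (simp add: \<phi>)
  qed
  also have "\<dots> < ereal (ln (u y0))"
  proof -
    define A where "A = r\<^sup>2 * (qh 1 1 / 2 - P * (p \<bullet> qf 1 1) + \<kappa>)"
    define C where "C = r\<^sup>2 * (qh \<i> \<i> / 2 - P * (p \<bullet> qf \<i> \<i>) + \<kappa>)"
    define B where "B = r\<^sup>2 * ((qh 1 \<i> + qh \<i> 1) / 2 - P * (p \<bullet> (qf 1 \<i> + qf \<i> 1)))"
    \<comment> \<open>Harmonicity of \<open>f\<close> cancels the penalty terms in
      \<open>A + C\<close>.\<close>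
    have "qf \<i> \<i> = - qf 1 1"
      using f(2) D(2) by (auto simp: harmonic_map_on_def qf_def eq_neg_iff_add_eq_0 add.commute)
    then have "A + C = r\<^sup>2 * (- 2 * \<kappa>)"
      unfolding A_def C_def \<kappa>_def by (simp add: field_simps)
    then have AC: "A + C < 0"
      using r \<open>\<kappa> > 0\<close> by (simp add: mult_pos_neg)
    have *: "?w (of_real r * cis t) \<le> 0 \<and> ?w (of_real r * cis t) \<le>
      ereal (ln (u y0) + (r * dderiv h 1 z0) * cos t + (r * dderiv h \<i> z0) * sin t +
      A * (cos t)\<^sup>2 + B * (cos t * sin t) + C * (sin t)\<^sup>2)" for t
    proof -
      define \<zeta> where "\<zeta> = of_real r * cis t"
      have n: "norm \<zeta> = r" "\<zeta> \<noteq> 0" using r by (auto simp: \<zeta>_def norm_mult)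
      note d\<zeta> = d(2)[OF n(2), unfolded n(1), OF r(2)]
      have w0: "?w (of_real r * cis t) \<le> 0"
        using d\<zeta> elog_le unfolding \<zeta>_def[symmetric] by blast
      have \<zeta>: "\<zeta> = (r * cos t) *\<^sub>R 1 + (r * sin t) *\<^sub>R \<i>"
        by (simp add: \<zeta>_def complex_eq_iff)
      have qh: "qh \<zeta> \<zeta> = r\<^sup>2 * (qh 1 1 * (cos t)\<^sup>2 + (qh 1 \<i> + qh \<i> 1) * (cos t * sin t) + qh \<i> \<i> * (sin t)\<^sup>2)"
        unfolding \<zeta> bilinear_ladd[OF bh] bilinear_radd[OF bh] bilinear_lmul[OF bh] bilinear_rmul[OF bh]
        by (simp add: algebra_simps power2_eq_square)
      have qf: "qf \<zeta> \<zeta> = r\<^sup>2 *\<^sub>R ((cos t)\<^sup>2 *\<^sub>R qf 1 1 + (cos t * sin t) *\<^sub>R (qf 1 \<i> + qf \<i> 1) + (sin t)\<^sup>2 *\<^sub>R qf \<i> \<i>)"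
        unfolding \<zeta> bilinear_ladd[OF bf] bilinear_radd[OF bf] bilinear_lmul[OF bf] bilinear_rmul[OF bf]
        by (simp add: algebra_simps power2_eq_square)
      have Dh: "dderiv h \<zeta> z0 = r * cos t * dderiv h 1 z0 + r * sin t * dderiv h \<i> z0"
        unfolding \<zeta> linear_add[OF linh] linear_scale[OF linh] by simp
      moreover have "?w \<zeta> \<le> ereal (ln (u y0) + (r * dderiv h 1 z0) * cos t + (r * dderiv h \<i> z0) * sin t +
        A * (cos t)\<^sup>2 + B * (cos t * sin t) + C * (sin t)\<^sup>2)"
      proof (cases "u (y0 + L \<zeta>) = 0")
        case False
        then have pos: "u (y0 + L \<zeta>) > 0" using u01[of "y0 + L \<zeta>"] d\<zeta> by simp
        have "ln (u (y0 + L \<zeta>) * exp (- h (z0 + \<zeta>) - P * (norm (y0 + L \<zeta> - f (z0 + \<zeta>)))\<^sup>2))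
          \<le> ln (u y0 * exp (- h z0 - P * (norm p)\<^sup>2))"
          using d\<zeta> pos y0 by (subst ln_le_cancel_iff) auto
        then have "ln (u (y0 + L \<zeta>)) \<le> ln (u y0) + E \<zeta> + dderiv h \<zeta> z0 + (1/2) * qh \<zeta> \<zeta> - P * (p \<bullet> qf \<zeta> \<zeta>)"
          using pos y0 by (simp add: ln_mult E_def algebra_simps)
        moreover have "E \<zeta> \<le> \<kappa> * r\<^sup>2"
          using d\<zeta> r n by (simp add: divide_simps)
        \<comment> \<open>The error bound is spread over the squares of cosine and sine, so that
          \<open>A\<close> and \<open>C\<close> absorb it.\<close>
        then have "E \<zeta> \<le> (\<kappa> * r\<^sup>2) * (cos t)\<^sup>2 + (\<kappa> * r\<^sup>2) * (sin t)\<^sup>2"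
          by (simp add: distrib_left[symmetric] del: distrib_left)
        ultimately have "ln (u (y0 + L \<zeta>)) \<le> ln (u y0) + (r * dderiv h 1 z0) * cos t + (r * dderiv h \<i> z0) * sin t +
          A * (cos t)\<^sup>2 + B * (cos t * sin t) + C * (sin t)\<^sup>2"
          unfolding qh qf Dh A_def B_def C_def by (simp add: inner_add_right algebra_simps add_divide_distrib)
        then show ?thesis using pos by (simp add: elog_def)
      qed (simp add: elog_def)
      ultimately show ?thesis using w0 unfolding \<zeta>_def by blast
    qed
    show ?thesis
      by (rule circle_mean_less[OF _ _ AC]) (use * in blast)+
  qed
  finally show False using y0 by (simp add: elog_def)
qed

lemma C1_on_subset: "C1_on f S \<Longrightarrow> T \<subseteq> S \<Longrightarrow> C1_on f T"
  unfolding C1_on_def using continuous_on_subset by blast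

lemma C2_on_subset: "C2_on f S \<Longrightarrow> T \<subseteq> S \<Longrightarrow> C2_on f T"
  unfolding C2_on_def using C1_on_subset by blast

lemma harmonic_map_on_subset: "harmonic_map_on f S \<Longrightarrow> T \<subseteq> S \<Longrightarrow> harmonic_map_on f T"
  unfolding harmonic_map_on_def using C2_on_subset by blast

lemma conformal_map_on_subset: "conformal_map_on f S \<Longrightarrow> T \<subseteq> S \<Longrightarrow> conformal_map_on f T"
  unfolding conformal_map_on_def using C1_on_subset by blast

text \<open>A failure at \<open>z1\<close> gives a ratio \<open>c > 1\<close>. With the variables
  doubled on the compact set \<open>K \<times> A\<close>, one fixed penalty factor \<open>P\<close>
  forces the maximum into the interior, where \<open>no_interior_max_penalised\<close> excludes
  it.\<close>

lemma comparison_principle: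
  fixes f :: "complex \<Rightarrow> 'a::euclidean_space" and h :: "complex \<Rightarrow> real" and u :: "'a \<Rightarrow> real"
  assumes mpsh: "mpsh_on \<Omega> (\<lambda>y. elog (u y))" and usc: "usc_on \<Omega> (\<lambda>y. ereal (u y))"
    and "open \<Omega>" and u01: "\<And>y. y \<in> \<Omega> \<Longrightarrow> 0 \<le> u y \<and> u y \<le> 1"
    and f: "conformal_map_on f D" "harmonic_map_on f D" "f ` D \<subseteq> \<Omega>"
    and A: "compact A" "A \<subseteq> D"
    and h: "continuous_on A h" "C2_on h (interior A)"
    and lap: "\<And>z. z \<in> interior A \<Longrightarrow> dderiv (dderiv h 1) 1 z + dderiv (dderiv h \<i>) \<i> z < 0"
    and bdry: "\<And>z. z \<in> A \<Longrightarrow> z \<notin> interior A \<Longrightarrow> u (f z) \<le> exp (h z)"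
    and z1: "z1 \<in> A"
  shows "u (f z1) \<le> exp (h z1)"
proof (rule ccontr)
  assume "\<not> u (f z1) \<le> exp (h z1)"
  then have neg: "exp (h z1) < u (f z1)" by simp
  define c where "c = u (f z1) * exp (- h z1)"
  have c: "c > 1"
    using mult_strict_right_mono[OF neg, of "exp (- h z1)"] by (simp add: c_def exp_minus)
  have contf: "continuous_on A f"
    using f(2) A(2) unfolding harmonic_map_on_def C2_on_def C1_on_def
    by (meson continuous_at_imp_continuous_on differentiable_imp_continuous_within subsetD)
  have "compact (f ` A)" "f ` A \<subseteq> \<Omega>"
    using contf A f(3) compact_continuous_image by auto
  then obtain e where e: "e > 0" "(\<Union>x\<in>f ` A. cball x e) \<subseteq> \<Omega>"
    using compact_subset_open_imp_cball_epsilon_subset \<open>open \<Omega>\<close> by blast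
  \<comment> \<open>A compact neighbourhood of the image of \<open>A\<close>: the point
    \<open>y\<close> can move around \<open>f z\<close> without leaving
    \<open>\<Omega>\<close>.\<close>
  define K where "K = (\<Union>x\<in>f ` A. cball x e)"
  have K: "compact K" "K \<subseteq> \<Omega>"
    using compact_minkowski_sum_cball[OF \<open>compact (f ` A)\<close>] e by (auto simp: K_def)
  have fK: "f z \<in> interior K" if "z \<in> A" for z
  proof (rule interiorI)
    show "ball (f z) e \<subseteq> K" using that unfolding K_def by force
  qed (use e in auto)
  let ?S = "K \<times> A"
  have "compact ?S" using K A by (simp add: compact_Times)
  have "continuous_on ?S (snd :: 'a \<times> complex \<Rightarrow> complex)"
    by (rule continuous_on_snd[OF continuous_on_id])
  then have contS: "continuous_on ?S (\<lambda>p. f (snd p))" "continuous_on ?S (\<lambda>p. h (snd p))"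
    using continuous_on_compose2[OF contf] continuous_on_compose2[OF h(1)] by (metis snd_image_times subset_refl empty_subsetI)+
  have uscS: "openin (top_of_set ?S) {p\<in>?S. u (fst p) < a}" for a
  proof -
    have "openin (top_of_set \<Omega>) {y\<in>\<Omega>. u y < a}"
      using usc unfolding usc_on_def by (metis (no_types, lifting) Collect_cong less_ereal.simps(1))
    then obtain V where V: "open V" "{y\<in>\<Omega>. u y < a} = \<Omega> \<inter> V"
      unfolding openin_open by auto
    have "{p\<in>?S. u (fst p) < a} = ?S \<inter> fst -` V"
    proof -
      have "u y < a \<longleftrightarrow> y \<in> V" if "y \<in> K" for y
        using V(2) K(2) that by blast
      then show ?thesis by auto
    qed
    moreover have "open (fst -` V :: ('a \<times> complex) set)"
      using V(1) by (simp add: open_vimage_fst)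
    ultimately show ?thesis by (simp add: openin_open_Int)
  qed
  have usc_mult: "openin (top_of_set ?S) {p\<in>?S. u (fst p) * exp (- q p) < a}"
    if "continuous_on ?S q" for q a
  proof -
    have "openin (top_of_set ?S) {p\<in>?S. u (fst p) < a * exp (q p)}"
      by (rule openin_less_continuous[OF uscS]) (intro continuous_intros that)
    moreover have "u (fst p) * exp (- q p) < a \<longleftrightarrow> u (fst p) < a * exp (q p)" for p
    proof -
      have "exp (- q p) * exp (q p) = 1" by (simp add: exp_add[symmetric])
      then have "u (fst p) * exp (- q p) * exp (q p) = u (fst p)"
        by (simp only: mult.assoc mult_1_right)
      then show ?thesis
        using mult_less_cancel_right_pos[OF exp_gt_zero, of "u (fst p) * exp (- q p)" "q p" a] by metis
    qed
    ultimately show ?thesis by simp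
  qed
  \<comment> \<open>The penalty only lowers values, so any point where the penalised function
    reaches \<open>c\<close> lies in \<open>T\<close>.\<close>
  define T where "T = {p\<in>?S. c \<le> u (fst p) * exp (- h (snd p))}"
  have "closedin (top_of_set ?S) T"
  proof -
    have "?S - T = {p\<in>?S. u (fst p) * exp (- h (snd p)) < c}" by (auto simp: T_def)
    moreover have "T \<subseteq> ?S" by (auto simp: T_def)
    ultimately show ?thesis
      using usc_mult[OF contS(2), of c] unfolding closedin_def by simp
  qed
  then have "compact T" using \<open>compact ?S\<close> closedin_compact by blast
  define Bad where "Bad = T \<inter> (- (interior K \<times> interior A))"
  have "compact Bad"
    unfolding Bad_def by (intro compact_Int_closed \<open>compact T\<close> closed_Compl open_Times open_interior)
  have Bad_pos: "0 < norm (fst p - f (snd p))" if "p \<in> Bad" for p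
  proof (rule ccontr)
    assume "\<not> ?thesis"
    then have eq: "fst p = f (snd p)" by simp
    have p: "fst p \<in> K" "snd p \<in> A" "c \<le> u (fst p) * exp (- h (snd p))"
      using that by (auto simp: Bad_def T_def)
    moreover have "snd p \<notin> interior A"
      using that fK[OF p(2)] eq by (cases p) (auto simp: Bad_def)
    ultimately have "u (fst p) \<le> exp (h (snd p))"
      using bdry eq by metis
    then have "u (fst p) * exp (- h (snd p)) \<le> exp (h (snd p)) * exp (- h (snd p))"
      by (intro mult_right_mono) auto
    then show False using p(3) c by (simp add: exp_minus)
  qed
  obtain m where m: "m > 0" "\<And>p. p \<in> Bad \<Longrightarrow> m \<le> (norm (fst p - f (snd p)))\<^sup>2"
  proof (cases "Bad = {}")
    case False
    have "continuous_on Bad (\<lambda>p. (norm (fst p - f (snd p)))\<^sup>2)"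
      by (intro continuous_intros continuous_on_subset[OF contS(1)]) (auto simp: Bad_def T_def)
    then obtain p where "p \<in> Bad" "\<forall>q\<in>Bad. (norm (fst p - f (snd p)))\<^sup>2 \<le> (norm (fst q - f (snd q)))\<^sup>2"
      using continuous_attains_inf[OF \<open>compact Bad\<close> False] by blast
    then show ?thesis using that[of "(norm (fst p - f (snd p)))\<^sup>2"] Bad_pos by simp
  qed (use that[of 1] in auto)
  obtain z2 where z2: "z2 \<in> A" "\<And>z. z \<in> A \<Longrightarrow> h z2 \<le> h z"
    using continuous_attains_inf[OF A(1) _ h(1)] z1 by blast
  \<comment> \<open>On \<open>Bad\<close> the penalty is at least the absolute value of the minimum
    \<open>h z2\<close>. Hence \<open>q\<close> is nonnegative there and \<open>g\<close> is at most
    1, which is less than \<open>c\<close>.\<close>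
  define P where "P = \<bar>h z2\<bar> / m"
  have "P \<ge> 0" using m by (simp add: P_def)
  define q where "q p = h (snd p) + P * (norm (fst p - f (snd p)))\<^sup>2" for p
  have "continuous_on ?S q"
    unfolding q_def by (intro continuous_intros contS)
  define g where "g p = u (fst p) * exp (- q p)" for p
  have "\<exists>p\<in>?S. \<forall>p'\<in>?S. g p' \<le> g p"
    by (rule usc_attains_sup[OF \<open>compact ?S\<close>])
      (use z1 fK interior_subset usc_mult[OF \<open>continuous_on ?S q\<close>] in \<open>auto simp: g_def\<close>)
  then obtain y0 z0 where p0: "y0 \<in> K" "z0 \<in> A" and max: "\<And>y z. y \<in> K \<Longrightarrow> z \<in> A \<Longrightarrow> g (y, z) \<le> g (y0, z0)"
    by auto
  have "f z1 \<in> K" using fK[OF z1] interior_subset by blast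
  then have "c \<le> g (y0, z0)"
    using max[OF _ z1, of "f z1"] by (simp add: g_def q_def c_def)
  have u0: "0 \<le> u y0" "u y0 \<le> 1" using u01 p0 K by auto
  have "g (y0, z0) \<le> u y0 * exp (- h z0)"
    unfolding g_def q_def using u0 \<open>P \<ge> 0\<close> by (auto intro!: mult_left_mono)
  then have "(y0, z0) \<in> T"
    using p0 \<open>c \<le> g (y0, z0)\<close> by (auto simp: T_def)
  have "(y0, z0) \<notin> Bad"
  proof
    assume "(y0, z0) \<in> Bad"
    then have "\<bar>h z2\<bar> \<le> P * (norm (y0 - f z0))\<^sup>2"
      using m(2)[of "(y0, z0)"] \<open>P \<ge> 0\<close> m(1) mult_left_mono[of m _ P] by (fastforce simp: P_def)
    then have "- q (y0, z0) \<le> 0"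
      using z2(2)[OF p0(2)] by (simp add: q_def)
    then have "g (y0, z0) \<le> 1 * 1"
      unfolding g_def using u0 by (intro mult_mono) auto
    then show False using \<open>c \<le> g (y0, z0)\<close> c by simp
  qed
  then have int: "y0 \<in> interior K" "z0 \<in> interior A"
    using \<open>(y0, z0) \<in> T\<close> by (auto simp: Bad_def)
  have u0pos: "u y0 > 0"
    using \<open>c \<le> g (y0, z0)\<close> c u0 by (cases "u y0 = 0") (auto simp: g_def)
  have sub: "interior A \<subseteq> D" using A(2) interior_subset by blast
  have z0D: "z0 \<in> D" using sub int by blast
  have "\<forall>\<^sub>F \<zeta> in at 0. z0 + \<zeta> \<in> interior A"
  proof (rule topological_tendstoD)
    show "((\<lambda>\<zeta>. z0 + \<zeta>) \<longlongrightarrow> z0 + 0) (at 0)" by (intro tendsto_intros)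
  qed (use int in auto)
  moreover have "\<forall>\<^sub>F \<zeta> in at 0. y0 + dderiv f \<zeta> z0 \<in> interior K"
  proof (rule topological_tendstoD)
    have "f differentiable at z0"
      using f(2) z0D C2_on_differentiable(1) unfolding harmonic_map_on_def by blast
    then have bl: "bounded_linear (\<lambda>\<zeta>. dderiv f \<zeta> z0)"
      using has_derivative_dderiv has_derivative_bounded_linear by blast
    have "((\<lambda>\<zeta>. dderiv f \<zeta> z0) \<longlongrightarrow> dderiv f 0 z0) (at 0)"
      using bl tendsto_ident_at by (rule bounded_linear.tendsto)
    then show "((\<lambda>\<zeta>. y0 + dderiv f \<zeta> z0) \<longlongrightarrow> y0 + dderiv f 0 z0) (at 0)"
      by (intro tendsto_intros)
    show "y0 + dderiv f 0 z0 \<in> interior K"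
      using int linear_0[OF bounded_linear.linear[OF bl]] by simp
  qed auto
  ultimately have ev: "\<forall>\<^sub>F \<zeta> in at 0. u (y0 + dderiv f \<zeta> z0) *
        exp (- h (z0 + \<zeta>) - P * (norm (y0 + dderiv f \<zeta> z0 - f (z0 + \<zeta>)))\<^sup>2)
      \<le> u y0 * exp (- h z0 - P * (norm (y0 - f z0))\<^sup>2)"
  proof eventually_elim
    case (elim \<zeta>)
    then have "y0 + dderiv f \<zeta> z0 \<in> K" "z0 + \<zeta> \<in> A" using interior_subset by auto
    from max[OF this] show ?case by (simp add: g_def q_def)
  qed
  show False
    by (rule no_interior_max_penalised[OF mpsh \<open>open \<Omega>\<close> u01 conformal_map_on_subset[OF f(1) sub]
      harmonic_map_on_subset[OF f(2) sub] h(2) open_interior int(2) lap[OF int(2)] _ u0pos ev])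
      (use p0 K in auto)
qed

section \<open>Logarithmic barriers and a Schwarz lemma\<close>

text \<open>\<open>ln (z \<bullet> z)\<close> is twice the logarithm of the modulus, hence harmonic
  off the origin, and \<open>z \<bullet> z\<close> has Laplacian 4. For \<open>e > 0\<close> this
  supplies strictly superharmonic barriers.\<close>

lemma laplacian_log_quadratic:
  fixes c d e :: real
  defines "h \<equiv> \<lambda>z::complex. c * ln (z \<bullet> z) + d - e * (z \<bullet> z)"
  shows "C2_on h (- {0})"
    and "z \<noteq> 0 \<Longrightarrow> dderiv (dderiv h 1) 1 z + dderiv (dderiv h \<i>) \<i> z = - 4 * e"
proof -
  define N where "N z = z \<bullet> z" for z :: complex
  define p where "p v z = z \<bullet> v" for v z :: complex
  \<comment> \<open>Off the origin, \<open>h1 v\<close> is the derivative of \<open>h\<close> in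
    direction \<open>v\<close>, and \<open>h2 v w\<close> that of \<open>h1 v\<close> in direction
    \<open>w\<close>.\<close>
  define h1 where "h1 v z = 2 * c * p v z / N z - 2 * e * p v z" for v z
  define h2 where "h2 v w z = 2 * c * (p v w * N z - p v z * (2 * p w z)) / (N z * N z)
    - 2 * e * p v w" for v w z
  have h: "h = (\<lambda>z. c * ln (N z) + d - e * N z)" by (simp add: h_def N_def)
  have N0: "N z > 0" if "z \<noteq> 0" for z using that by (simp add: N_def)
  have dN: "(N has_derivative (\<lambda>v. 2 * p v z)) (at z)" for z
    unfolding N_def p_def
    by (rule has_derivative_eq_rhs[OF has_derivative_inner[OF has_derivative_ident has_derivative_ident]])
      (simp add: fun_eq_iff inner_commute)
  have dp: "(p v has_derivative p v) (at z)" for v z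
    unfolding p_def by (rule bounded_linear_imp_has_derivative[OF bounded_linear_inner_left])
  have d1: "(h has_derivative (\<lambda>v. h1 v z)) (at z)" if "z \<noteq> 0" for z
    unfolding h h1_def using N0[OF that]
    by (auto intro!: derivative_eq_intros dN simp: fun_eq_iff divide_simps)
  have d2: "(h1 v has_derivative (\<lambda>w. h2 v w z)) (at z)" if "z \<noteq> 0" for v z
    unfolding h1_def h2_def using N0[OF that]
    by (auto intro!: derivative_eq_intros dN dp simp: fun_eq_iff)
      (auto simp: field_simps)
  have D1: "dderiv h v z = h1 v z" if "z \<noteq> 0" for v z
    using dderiv_eqI[OF d1[OF that]] .
  have d3: "(dderiv h v has_derivative (\<lambda>w. h2 v w z)) (at z)" if "z \<noteq> 0" for v z
    by (rule has_derivative_transform_within_open[OF d2[OF that], of "- {0}"])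
      (use that D1 in auto)
  have D2: "dderiv (dderiv h v) w z = h2 v w z" if "z \<noteq> 0" for v w z
    using dderiv_eqI[OF d3[OF that]] .
  have c1: "continuous_on (- {0}) (h1 v)" and c2: "continuous_on (- {0}) (h2 v w)" for v w
    unfolding h1_def h2_def N_def p_def by (auto intro!: continuous_intros)
  have "continuous_on (- {0}) (dderiv h v)" for v
    by (rule continuous_on_eq[OF c1]) (simp add: D1)
  moreover have "continuous_on (- {0}) (dderiv (dderiv h v) w)" for v w
    by (rule continuous_on_eq[OF c2]) (simp add: D2)
  moreover have "h differentiable at z" "dderiv h v differentiable at z" if "z \<noteq> 0" for v z
    using d1[OF that] d3[OF that] differentiableI by blast+
  ultimately show "C2_on h (- {0})"
    by (auto simp: C2_on_def C1_on_def)
  show "dderiv (dderiv h 1) 1 z + dderiv (dderiv h \<i>) \<i> z = - 4 * e" if "z \<noteq> 0"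
  proof -
    have N: "N z = (p 1 z)\<^sup>2 + (p \<i> z)\<^sup>2"
      by (simp add: N_def p_def inner_complex_def power2_eq_square)
    have "h2 1 1 z + h2 \<i> \<i> z
        = 4 * c * (N z - ((p 1 z)\<^sup>2 + (p \<i> z)\<^sup>2)) / (N z * N z) - 4 * e"
      unfolding h2_def by (simp add: p_def[of 1 1] p_def[of \<i> \<i>] add_divide_distrib diff_divide_distrib
        algebra_simps power2_eq_square)
    also have "\<dots> = - 4 * e" using N by simp
    finally have "h2 1 1 z + h2 \<i> \<i> z = - 4 * e" .
    then show ?thesis using D2[OF that] by simp
  qed
qed

text \<open>The first-order term of the expansion vanishes because \<open>x\<close> is a minimum of
  \<open>u\<close> on \<open>U\<close>.\<close>

lemma C2_on_min_taylor:
  fixes u :: "'a::euclidean_space \<Rightarrow> real"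
  assumes "C2_on u U" "open U" "x \<in> U" and min: "u x = 0" "\<And>y. y \<in> U \<Longrightarrow> 0 \<le> u y"
  shows "((\<lambda>k. (u (x + k) - (1/2) * Hess u x k) / (norm k)\<^sup>2) \<longlongrightarrow> 0) (at 0)"
proof -
  have "(u has_derivative (\<lambda>v. dderiv u v x)) (at x)"
    by (intro has_derivative_dderiv C2_on_differentiable(1)[OF assms(1,3)])
  then have "(\<lambda>v. dderiv u v x) = (\<lambda>v. 0)"
    by (rule differential_zero_maxmin[OF assms(3,2)]) (use min in auto)
  then have "dderiv u v x = 0" for v by (rule fun_cong)
  then show ?thesis
    using C2_on_taylor[OF assms(1-3)] min(1) by (simp only: Hess_def real_scaleR_def divide_inverse mult.commute diff_zero)
qed

text \<open>Near its minimum \<open>u\<close> is bounded by a multiple of the squared distance to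
  \<open>x\<close>, and that distance grows at most linearly along \<open>f\<close>. This controls
  \<open>u\<close> along \<open>f\<close> on small circles, where the logarithmic barrier is very
  negative.\<close>

lemma quadratic_growth:
  fixes f :: "complex \<Rightarrow> 'a::euclidean_space" and u :: "'a \<Rightarrow> real"
  assumes "C2_on u U" "open U" "x \<in> U" and min: "u x = 0" "\<And>y. y \<in> U \<Longrightarrow> 0 \<le> u y"
    and f: "f differentiable at 0" "f 0 = x"
  shows "\<exists>C\<ge>1. \<exists>d>0. \<forall>z. norm z < d \<longrightarrow> u (f z) \<le> C * (norm z)\<^sup>2"
proof -
  have "bilinear (\<lambda>v w. dderiv (dderiv u v) w x)"
    by (rule bilinear_dderiv2[OF assms(1-3)])
  then obtain B where "B > 0" "\<And>v w. norm (dderiv (dderiv u v) w x) \<le> B * norm v * norm w"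
    using bilinear_bounded_pos[of "\<lambda>v w. dderiv (dderiv u v) w x"] by auto
  then have B: "B > 0" "Hess u x v \<le> B * (norm v)\<^sup>2" for v
    unfolding Hess_def power2_eq_square real_norm_def by (auto simp: mult.assoc abs_le_iff)
  have "\<forall>\<^sub>F k in at 0. (u (x + k) - (1/2) * Hess u x k) / (norm k)\<^sup>2 < 1"
    using C2_on_min_taylor[OF assms(1-5)] by (rule order_tendstoD) auto
  then obtain d1 where d1: "d1 > 0" "\<And>k. k \<noteq> 0 \<Longrightarrow> norm k < d1 \<Longrightarrow>
      (u (x + k) - (1/2) * Hess u x k) / (norm k)\<^sup>2 < 1"
    unfolding eventually_at by auto
  have u: "u (x + k) \<le> (B / 2 + 1) * (norm k)\<^sup>2" if "norm k < d1" for k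
  proof (cases "k = 0")
    case False
    then have "u (x + k) \<le> (1/2) * Hess u x k + (norm k)\<^sup>2"
      using d1(2)[OF False that] by (simp add: divide_simps)
    then show ?thesis using B(2)[of k] by (simp add: distrib_right)
  qed (use min in simp)
  define L where "L v = dderiv f v 0" for v
  have L: "(f has_derivative L) (at 0)"
    unfolding L_def by (rule has_derivative_dderiv[OF f(1)])
  then have bl: "bounded_linear L" by (rule has_derivative_bounded_linear)
  obtain d2 where d2: "d2 > 0" "\<And>z. norm z < d2 \<Longrightarrow> norm (f z - f 0 - L z) \<le> 1 * norm z"
    using L unfolding has_derivative_at_alt by (metis diff_zero zero_less_one)
  define M where "M = onorm L + 1"
  have "M > 0" using onorm_pos_le[OF bl] by (simp add: M_def)
  have fM: "norm (f z - x) \<le> M * norm z" if "norm z < d2" for z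
  proof -
    have "norm (f z - x) \<le> norm (f z - f 0 - L z) + norm (L z)"
      using norm_triangle_sub[of "f z - x" "L z"] f(2) by (simp add: add.commute)
    also have "\<dots> \<le> M * norm z"
      using d2(2)[OF that] onorm[OF bl, of z] by (simp add: M_def algebra_simps)
    finally show ?thesis .
  qed
  show ?thesis
  proof (intro exI conjI allI impI)
    \<comment> \<open>The maximum with 1 keeps the constant positive, so that its logarithm can be
      used in the choice of a radius.\<close>
    show "max 1 ((B / 2 + 1) * M\<^sup>2) \<ge> 1" by simp
    show "min d2 (d1 / M) > 0" using d1 d2 \<open>M > 0\<close> by simp
    fix z :: complex assume z: "norm z < min d2 (d1 / M)"
    have "M * norm z < d1" using z \<open>M > 0\<close> by (simp add: pos_less_divide_eq mult.commute)
    then have "norm (f z - x) < d1" using fM[of z] z by simp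
    then have "u (f z) \<le> (B / 2 + 1) * (norm (f z - x))\<^sup>2"
      using u[of "f z - x"] by simp
    also have "\<dots> \<le> (B / 2 + 1) * (M * norm z)\<^sup>2"
      using fM[of z] z B(1) by (intro mult_left_mono power_mono) auto
    also have "\<dots> \<le> max 1 ((B / 2 + 1) * M\<^sup>2) * (norm z)\<^sup>2"
      by (simp add: power_mult_distrib mult.assoc[symmetric] mult_right_mono)
    finally show "u (f z) \<le> max 1 ((B / 2 + 1) * M\<^sup>2) * (norm z)\<^sup>2" .
  qed
qed

text \<open>Compare with \<open>H t\<close> on the annulus between \<open>s\<close> and
  \<open>1 - t\<close>. On the outer circle \<open>H t\<close> is nonnegative while \<open>u\<close>
  is at most 1; on the inner circle \<open>H t\<close> dominates the logarithm of the quadratic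
  growth bound. As \<open>t\<close> tends to 0, \<open>H t z\<close> tends to
  \<open>ln (z \<bullet> z)\<close>.\<close>

lemma schwarz_lemma:
  fixes f :: "complex \<Rightarrow> 'a::euclidean_space" and u :: "'a \<Rightarrow> real"
  assumes "open \<Omega>" and u: "u \<in> F_class \<Omega> x" and f: "f \<in> CH (ball 0 1) \<Omega>" "f 0 = x"
    and z: "norm z < 1"
  shows "u (f z) \<le> (norm z)\<^sup>2"
proof (cases "z = 0")
  case True
  then show ?thesis using u f by (simp add: F_class_def)
next
  case False
  obtain U where U: "open U" "x \<in> U" "U \<subseteq> \<Omega>" "C2_on u U"
    using u by (auto simp: F_class_def)
  have u01: "\<And>y. y \<in> \<Omega> \<Longrightarrow> 0 \<le> u y \<and> u y \<le> 1" and "u x = 0"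
    and mpsh: "mpsh_on \<Omega> (\<lambda>y. elog (u y))" and usc: "usc_on \<Omega> (\<lambda>y. ereal (u y))"
    using u by (auto simp: F_class_def mpsh_on_def)
  have cf: "conformal_map_on f (ball 0 1)" "harmonic_map_on f (ball 0 1)" "f ` ball 0 1 \<subseteq> \<Omega>"
    using f by (auto simp: CH_def)
  have df: "f differentiable at 0"
    using cf(2) C2_on_differentiable(1)[of f "ball 0 1" 0] by (simp add: harmonic_map_on_def)
  obtain C d where C: "C \<ge> 1" "d > 0" "\<And>z. norm z < d \<Longrightarrow> u (f z) \<le> C * (norm z)\<^sup>2"
    using quadratic_growth[OF U(4,1,2) \<open>u x = 0\<close> _ df f(2)] u01 U(3) by blast
  txt \<open>The slope \<open>2 * (1 - t) < 2\<close> of the logarithm beats the quadratic growth of \<open>u \<circ> f\<close> near \<open>0\<close>;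
    the term \<open>- t * (w \<bullet> w)\<close> makes \<open>H t\<close> strictly superharmonic.\<close>
  define H where "H t w = (1 - t) * ln (w \<bullet> w) + (t - 2 * (1 - t) * ln (1 - t)) - t * (w \<bullet> w)"
    for t :: real and w :: complex
  \<comment> \<open>The additive constant in \<open>H t\<close> is chosen so that the logarithmic
    part vanishes on the circle of radius \<open>1 - t\<close>.\<close>
  have H_alt: "H t w = 2 * (1 - t) * (ln (norm w) - ln (1 - t)) + t * (1 - (norm w)\<^sup>2)" if "w \<noteq> 0" for t w
    using that by (simp add: H_def power2_norm_eq_inner[symmetric] ln_realpow algebra_simps)
  have le: "u (f z) \<le> exp (H t z)" if t: "0 < t" "norm z < 1 - t" for t
  proof -
    define \<rho> where "\<rho> = 1 - t"
    \<comment> \<open>The three bounds make the growth estimate valid on the inner circle, put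
      \<open>z\<close> into the annulus, and give
      \<open>ln C + 2 * ln s \<le> 2 * (1 - t) * ln s\<close>.\<close>
    define s where "s = min (min (d / 2) (norm z)) (exp (- ln C / (2 * t)))"
    have s: "0 < s" "s < d" "s \<le> norm z" using C(2) False by (auto simp: s_def)
    have "ln s \<le> - ln C / (2 * t)"
      using s(1) ln_le_cancel_iff[of s "exp (- ln C / (2 * t))"] by (simp add: s_def)
    then have lns: "ln C \<le> - 2 * t * ln s"
      using t by (simp add: field_simps)
    have \<rho>: "s < \<rho>" "\<rho> < 1" using s t by (auto simp: \<rho>_def)
    define A where "A = cball (0::complex) \<rho> - ball 0 s"
    have A: "compact A" "A \<subseteq> ball 0 1" "z \<in> A" "A \<subseteq> - {0}"
      using \<rho> s t by (auto simp: A_def \<rho>_def intro!: compact_diff)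
    have C2: "C2_on (H t) (- {0})" and lap: "\<And>w. w \<noteq> 0 \<Longrightarrow>
        dderiv (dderiv (H t) 1) 1 w + dderiv (dderiv (H t) \<i>) \<i> w = - 4 * t"
      using laplacian_log_quadratic unfolding H_def by blast+
    have intA: "interior A \<subseteq> - {0}" using A(4) interior_subset by blast
    have int: "w \<in> interior A" if "s < norm w" "norm w < \<rho>" for w
    proof (rule interiorI)
      show "open (ball 0 \<rho> - cball (0::complex) s)" by (intro open_Diff) auto
    qed (use that in \<open>auto simp: A_def\<close>)
    show ?thesis
    proof (rule comparison_principle[OF mpsh usc \<open>open \<Omega>\<close> u01 cf A(1,2) _ _ _ _ A(3)])
      show "continuous_on A (H t)"
        unfolding H_def using A(4) by (auto intro!: continuous_intros)
      show "C2_on (H t) (interior A)" using C2 intA by (rule C2_on_subset)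
      show "dderiv (dderiv (H t) 1) 1 w + dderiv (dderiv (H t) \<i>) \<i> w < 0" if "w \<in> interior A" for w
      proof -
        have "w \<noteq> 0" using intA that by auto
        then show ?thesis using lap[of w] t by simp
      qed
      fix w assume w: "w \<in> A" "w \<notin> interior A"
      then consider "norm w = \<rho>" | "norm w = s"
        using int[of w] by (fastforce simp: A_def)
      then show "u (f w) \<le> exp (H t w)"
      proof cases
        case 1
        then have "H t w = t * (1 - \<rho>\<^sup>2)"
          using H_alt[of w t] s \<rho> by (cases "w = 0") (auto simp: \<rho>_def)
        then have "0 \<le> H t w" using t \<rho> s by (simp add: power_le_one)
        moreover have "u (f w) \<le> 1" using u01 cf(3) w A(2) by blast
        ultimately show ?thesis by (meson one_le_exp_iff order_trans)
      next
        case 2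
        have "0 \<le> - (2 * (1 - t) * ln \<rho>)" "0 \<le> t * (1 - s\<^sup>2)"
          using \<rho> s t by (auto simp: \<rho>_def mult_nonneg_nonpos power_le_one)
        then have "2 * (1 - t) * ln s \<le> H t w"
          using H_alt[of w t] s 2 by (auto simp: \<rho>_def algebra_simps)
        then have "ln C + 2 * ln s \<le> H t w"
          using lns by (simp add: algebra_simps)
        then have "exp (ln C + 2 * ln s) \<le> exp (H t w)" by simp
        moreover have "exp (ln C + 2 * ln s) = C * s\<^sup>2"
          using C s by (simp add: exp_add exp_double)
        ultimately show ?thesis using C(3)[of w] 2 s by simp
      qed
    qed (use u01 in auto)
  qed
  \<comment> \<open>The inner radius no longer occurs in \<open>le\<close>, so only \<open>t\<close>
    has to tend to 0.\<close>
  have "((\<lambda>t. exp (H t z)) \<longlongrightarrow> exp (H 0 z)) (at_right 0)"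
    unfolding H_def by (intro tendsto_intros) auto
  moreover have "\<forall>\<^sub>F t in at_right 0. u (f z) \<le> exp (H t z)"
    unfolding eventually_at_right_field using z le by (intro exI[of _ "1 - norm z"]) auto
  ultimately have "u (f z) \<le> exp (H 0 z)"
    by (rule tendsto_lowerbound) simp
  then show ?thesis
    using False by (simp add: H_def power2_norm_eq_inner)
qed

section \<open>From the Schwarz bound to the trace of the Hessian\<close>

text \<open>Apply \<open>le\<close> at \<open>t *\<^sub>R z\<close>, divide by the square of
  \<open>t\<close> and let \<open>t\<close> tend to 0. The difference quotients of \<open>f\<close>
  tend to \<open>dderiv f z 0\<close>, and the left side tends to half the Hessian there.\<close>

lemma Hess_le_of_schwarz:
  fixes f :: "complex \<Rightarrow> 'a::euclidean_space" and u :: "'a \<Rightarrow> real"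
  assumes "C2_on u U" "open U" "x \<in> U" and min: "u x = 0" "\<And>y. y \<in> U \<Longrightarrow> 0 \<le> u y"
    and f: "f differentiable at 0" "f 0 = x"
    and le: "\<And>z. norm z < 1 \<Longrightarrow> u (f z) \<le> (norm z)\<^sup>2"
  shows "Hess u x (dderiv f z 0) \<le> 2 * (norm z)\<^sup>2"
proof -
  define b where "b = dderiv f z 0"
  define k where "k t = f (t *\<^sub>R z) - x" for t :: real
  define T where "T y = (u (x + y) - (1/2) * Hess u x y) / (norm y)\<^sup>2" for y
  note bil = bilinear_dderiv2[OF assms(1-3)]
  have Hscale: "Hess u x (c *\<^sub>R v) = c\<^sup>2 * Hess u x v" for c v
    unfolding Hess_def bilinear_lmul[OF bil] bilinear_rmul[OF bil] by (simp add: power2_eq_square)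
  have "(f has_derivative (\<lambda>v. dderiv f v 0)) (at (0 *\<^sub>R z))"
    using has_derivative_dderiv[OF f(1)] by simp
  then have "((\<lambda>t. f (t *\<^sub>R z)) has_derivative (\<lambda>s. dderiv f (s *\<^sub>R z) 0)) (at 0)"
    by (rule has_derivative_compose[where f = "\<lambda>t. t *\<^sub>R z" and g = f, rotated])
      (auto intro!: derivative_eq_intros)
  then have "((\<lambda>t. norm (k t - t *\<^sub>R b) / norm t) \<longlongrightarrow> 0) (at 0)"
    unfolding has_derivative_at k_def b_def
    by (simp add: f(2) linear_scale[OF linear_dderiv[OF f(1)]])
  moreover have "\<forall>\<^sub>F t in at 0. norm (k t - t *\<^sub>R b) / norm t = norm ((1 / t) *\<^sub>R k t - b)"
    unfolding eventually_at_filter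
  proof (intro always_eventually allI impI)
    fix t :: real assume "t \<noteq> 0"
    then have "(1 / t) *\<^sub>R k t - b = (1 / t) *\<^sub>R (k t - t *\<^sub>R b)"
      by (simp add: scaleR_diff_right)
    then show "norm (k t - t *\<^sub>R b) / norm t = norm ((1 / t) *\<^sub>R k t - b)" by simp
  qed
  ultimately have "((\<lambda>t. norm ((1 / t) *\<^sub>R k t - b)) \<longlongrightarrow> 0) (at 0)"
    by (rule Lim_transform_eventually)
  then have kb: "((\<lambda>t. (1 / t) *\<^sub>R k t) \<longlongrightarrow> b) (at 0)"
    using Lim_null tendsto_norm_zero_iff by blast
  have "((\<lambda>t. t *\<^sub>R ((1 / t) *\<^sub>R k t)) \<longlongrightarrow> 0 *\<^sub>R b) (at 0)"
    by (intro tendsto_scaleR kb tendsto_ident_at)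
  then have k0: "(k \<longlongrightarrow> 0) (at 0)"
    unfolding scaleR_zero_left by (rule Lim_transform_eventually) (auto simp: eventually_at_filter)
  \<comment> \<open>Division by zero gives \<open>T 0 = 0\<close>, so the Taylor limit is continuity
    of \<open>T\<close> at 0. This form allows composition with \<open>k\<close>, which may vanish
    at nonzero \<open>t\<close>.\<close>
  have "isCont T 0"
    using C2_on_min_taylor[OF assms(1-5)] by (simp add: isCont_def T_def[abs_def])
  then have "((\<lambda>t. T (k t)) \<longlongrightarrow> T 0) (at 0)"
    by (rule isCont_tendsto_compose[OF _ k0])
  then have Tk: "((\<lambda>t. T (k t)) \<longlongrightarrow> 0) (at 0)" by (simp add: T_def)
  have "((\<lambda>t. (norm z)\<^sup>2 - T (k t) * (norm ((1 / t) *\<^sub>R k t))\<^sup>2) \<longlongrightarrow> (norm z)\<^sup>2 - 0 * (norm b)\<^sup>2) (at 0)"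
    by (intro tendsto_diff tendsto_mult tendsto_const tendsto_power tendsto_norm Tk kb)
  moreover have "((\<lambda>t. (1/2) * Hess u x ((1 / t) *\<^sub>R k t)) \<longlongrightarrow> (1/2) * Hess u x b) (at 0)"
    unfolding Hess_def
    by (intro tendsto_mult tendsto_const
      bounded_bilinear.tendsto[OF bil[unfolded bilinear_conv_bounded_bilinear]] kb)
  moreover have "\<forall>\<^sub>F t in at 0. (1/2) * Hess u x ((1 / t) *\<^sub>R k t)
      \<le> (norm z)\<^sup>2 - T (k t) * (norm ((1 / t) *\<^sub>R k t))\<^sup>2"
  proof -
    have "((\<lambda>t. norm (t *\<^sub>R z)) \<longlongrightarrow> norm (0 *\<^sub>R z)) (at (0::real))"
      by (intro tendsto_norm tendsto_scaleR tendsto_const tendsto_ident_at)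
    then have "\<forall>\<^sub>F t in at 0. norm (t *\<^sub>R z) < 1"
      by (rule order_tendstoD) simp
    moreover have "\<forall>\<^sub>F t in at 0. t \<noteq> (0::real)"
      by (simp add: eventually_at_filter)
    ultimately show ?thesis
    proof eventually_elim
      case (elim t)
      have "u (x + k t) \<le> t\<^sup>2 * (norm z)\<^sup>2"
        using le[OF elim(1)] by (simp add: k_def power_mult_distrib)
      moreover have "u (x + k t) = (1/2) * Hess u x (k t) + T (k t) * (norm (k t))\<^sup>2"
        using min(1) Hscale[of 0 0] by (cases "k t = 0") (auto simp: T_def)
      ultimately have "(1 / t)\<^sup>2 * ((1/2) * Hess u x (k t) + T (k t) * (norm (k t))\<^sup>2)
          \<le> (1 / t)\<^sup>2 * (t\<^sup>2 * (norm z)\<^sup>2)"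
        by (intro mult_left_mono) auto
      moreover have "(1 / t)\<^sup>2 * (t\<^sup>2 * (norm z)\<^sup>2) = (norm z)\<^sup>2"
        using elim(2) by (simp add: power_divide)
      moreover have "(1 / t)\<^sup>2 * ((1/2) * Hess u x (k t) + T (k t) * (norm (k t))\<^sup>2)
          = (1/2) * ((1 / t)\<^sup>2 * Hess u x (k t)) + T (k t) * ((1 / t)\<^sup>2 * (norm (k t))\<^sup>2)"
        by (simp only: distrib_left mult.left_commute)
      moreover have n: "(norm ((1 / t) *\<^sub>R k t))\<^sup>2 = (1 / t)\<^sup>2 * (norm (k t))\<^sup>2"
        by (simp add: power_divide power_mult_distrib)
      ultimately show ?case
        unfolding Hscale n by linarith
    qed
  qed
  ultimately have "(1/2) * Hess u x b \<le> (norm z)\<^sup>2 - 0 * (norm b)\<^sup>2"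
    by (rule tendsto_le[OF at_neq_bot])
  then show ?thesis by (simp add: b_def)
qed

text \<open>Orthonormal bases of \<open>\<Lambda>\<close> exist, so the basis picked by
  \<open>SOME\<close> is one; it has \<open>dim \<Lambda>\<close> elements, each contributing at
  most \<open>c\<close>.\<close>

lemma trace_on_le:
  fixes \<Lambda> :: "'a::euclidean_space set" and c :: real
  assumes "subspace \<Lambda>" "\<And>b. b \<in> \<Lambda> \<Longrightarrow> norm b = 1 \<Longrightarrow> q b \<le> c"
  shows "trace_on \<Lambda> q \<le> dim \<Lambda> * c"
proof -
  define P where "P B \<longleftrightarrow> pairwise orthogonal B \<and> (\<forall>b\<in>B. norm b = 1) \<and> span B = \<Lambda>" for B :: "'a set"
  define B where "B = (SOME B. P B)"
  have "\<exists>B. P B"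
    using orthonormal_basis_subspace[OF assms(1)] unfolding P_def by metis
  then have "P B" unfolding B_def by (rule someI_ex)
  then have B: "pairwise orthogonal B" "\<And>b. b \<in> B \<Longrightarrow> norm b = 1" "span B = \<Lambda>"
    by (auto simp: P_def)
  have "0 \<notin> B" using B(2) by force
  then have "independent B"
    using B(1) pairwise_orthogonal_independent by blast
  then have "card B = dim \<Lambda>"
    using B(3) dim_span_eq_card_independent by metis
  have "trace_on \<Lambda> q = sum q B"
    by (simp add: trace_on_def B_def P_def)
  also have "\<dots> \<le> of_nat (card B) * c"
    by (rule sum_bounded_above) (use assms(2) B span_superset in blast)
  finally show ?thesis using \<open>card B = dim \<Lambda>\<close> by simp
qed

text \<open>By Pythagoras the differential of a conformal map scales all lengths by the same factor,
  possibly zero. That factor is therefore its operator norm.\<close>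

lemma norm_dderiv_conformal:
  assumes "conformal_map_on f S" "z \<in> S"
  shows "norm (dderiv f v z) = norm (dderiv f 1 z) * norm v"
proof -
  have lin: "linear (\<lambda>v. dderiv f v z)"
    using assms linear_dderiv by (auto simp: conformal_map_on_def C1_on_def)
  have "Re v *\<^sub>R 1 + Im v *\<^sub>R \<i> = v" by (simp add: complex_eq_iff)
  then have "dderiv f v z = Re v *\<^sub>R dderiv f 1 z + Im v *\<^sub>R dderiv f \<i> z"
    using linear_add[OF lin, of "Re v *\<^sub>R 1" "Im v *\<^sub>R \<i>"] by (simp add: linear_scale[OF lin])
  moreover have "norm (dderiv f 1 z) = norm (dderiv f \<i> z)" "dderiv f 1 z \<bullet> dderiv f \<i> z = 0"
    using assms by (auto simp: conformal_map_on_def)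
  ultimately have "(norm (dderiv f v z))\<^sup>2 = (Re v * norm (dderiv f 1 z))\<^sup>2 + (Im v * norm (dderiv f 1 z))\<^sup>2"
    using norm_add_Pythagorean[of "Re v *\<^sub>R dderiv f 1 z" "Im v *\<^sub>R dderiv f \<i> z"]
    by (simp add: orthogonal_def power_mult_distrib)
  also have "\<dots> = (norm (dderiv f 1 z) * norm v)\<^sup>2"
    by (simp add: power_mult_distrib cmod_power2 algebra_simps)
  finally show ?thesis by simp
qed

text \<open>With scale factor \<open>r\<close>, a unit vector of \<open>\<Lambda>\<close> is
  \<open>L z\<close> with \<open>norm z = 1 / r\<close>. Two orthonormal directions thus give a
  trace of at most 4 over the square of \<open>r\<close>, and half its root is
  \<open>1 / r\<close>.\<close>

lemma trace_Hess_le: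
  fixes f :: "complex \<Rightarrow> 'a::euclidean_space"
  assumes "open \<Omega>" and u: "u \<in> F_class \<Omega> x" and f: "f \<in> CH (ball 0 1) \<Omega>" "f 0 = x"
    and \<Lambda>: "range (frechet_derivative f (at 0)) = \<Lambda>" "\<Lambda> \<in> Grass2"
  shows "(1 / 2) * sqrt (trace_on \<Lambda> (Hess u x)) \<le> 1 / onorm (frechet_derivative f (at 0))"
proof -
  obtain U where U: "open U" "x \<in> U" "U \<subseteq> \<Omega>" "C2_on u U"
    using u by (auto simp: F_class_def)
  have u0: "u x = 0" "\<And>y. y \<in> U \<Longrightarrow> 0 \<le> u y"
    using u U(3) by (auto simp: F_class_def)
  have conf: "conformal_map_on f (ball 0 1)" using f by (simp add: CH_def)
  then have df: "f differentiable at 0" by (simp add: conformal_map_on_def C1_on_def)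
  define L where "L = frechet_derivative f (at 0)"
  have L: "L v = dderiv f v 0" for v by (simp add: L_def dderiv_def)
  define r where "r = norm (L 1)"
  have nL: "norm (L v) = r * norm v" for v
    using norm_dderiv_conformal[OF conf, of 0 v] by (simp add: L r_def)
  have sub: "subspace \<Lambda>" "dim \<Lambda> = 2" using \<Lambda> by (auto simp: Grass2_def)
  \<comment> \<open>A zero scale factor would collapse \<open>\<Lambda>\<close> to a point, whereas
    its dimension is 2.\<close>
  have "r \<noteq> 0"
  proof
    assume "r = 0"
    then have "\<Lambda> \<subseteq> {0}" using nL \<Lambda>(1) by (auto simp: L_def[symmetric])
    then show False using sub(2) dim_subset[of \<Lambda> "{0}"] by simp
  qed
  then have "r > 0" by (simp add: r_def)
  have "onorm L = r"
  proof (rule antisym)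
    show "onorm L \<le> r" by (rule onorm_le) (simp add: nL)
    have "bounded_linear L"
      unfolding L_def using df by (metis frechet_derivative_works has_derivative_bounded_linear)
    then show "r \<le> onorm L" using onorm[of L 1] by (simp add: r_def)
  qed
  have "Hess u x b \<le> 2 / r\<^sup>2" if b: "b \<in> \<Lambda>" "norm b = 1" for b
  proof -
    obtain z where z: "b = L z" using b(1) \<Lambda>(1) by (auto simp: L_def)
    then have "norm z = 1 / r" using nL[of z] b(2) \<open>r > 0\<close> by (simp add: field_simps)
    moreover have "Hess u x (dderiv f z 0) \<le> 2 * (norm z)\<^sup>2"
      by (rule Hess_le_of_schwarz[OF U(4,1,2) u0 df f(2)]) (use schwarz_lemma[OF assms(1) u f] in auto)
    ultimately show ?thesis by (simp add: z L power_divide)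
  qed
  then have "trace_on \<Lambda> (Hess u x) \<le> 2 * (2 / r\<^sup>2)"
    using trace_on_le[OF sub(1), of "Hess u x" "2 / r\<^sup>2"] sub(2) by simp
  also have "\<dots> = (2 / r)\<^sup>2" by (simp add: power_divide)
  \<comment> \<open>\<open>sqrt\<close> is monotone on the whole real line, so a negative trace is
    covered as well.\<close>
  finally have "sqrt (trace_on \<Lambda> (Hess u x)) \<le> 2 / r"
    using \<open>r > 0\<close> real_le_lsqrt by (metis divide_nonneg_pos real_sqrt_le_mono real_sqrt_unique zero_le_numeral)
  then show ?thesis
    unfolding L_def[symmetric] \<open>onorm L = r\<close> by simp
qed

theorem proposition7p6:
  fixes \<Omega> :: "(real ^ 'n) set"
  assumes "CARD('n) \<ge> 3"
    and "open \<Omega>" "connected \<Omega>" "\<Omega> \<noteq> {}"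
  shows "\<forall>x\<in>\<Omega>. \<forall>\<Lambda>\<in>Grass2. F_metric \<Omega> x \<Lambda> \<le> M_metric \<Omega> x \<Lambda>"
proof (intro ballI)
  fix x \<Lambda> assume "x \<in> \<Omega>" and \<Lambda>: "(\<Lambda> :: (real ^ 'n) set) \<in> Grass2"
  show "F_metric \<Omega> x \<Lambda> \<le> M_metric \<Omega> x \<Lambda>"
    unfolding M_metric_def
  proof (rule Inf_greatest)
    fix m assume "m \<in> {ereal (1 / onorm (frechet_derivative f (at 0))) | f.
          f \<in> CH (ball 0 1) \<Omega> \<and> f 0 = x \<and> range (frechet_derivative f (at 0)) = \<Lambda>}"
    then obtain f where m: "m = ereal (1 / onorm (frechet_derivative f (at 0)))"
      and f: "f \<in> CH (ball 0 1) \<Omega>" "f 0 = x" "range (frechet_derivative f (at 0)) = \<Lambda>"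
      by auto
    define c where "c = 1 / onorm (frechet_derivative f (at 0))"
    have "f differentiable at 0"
      using f(1) by (simp add: CH_def conformal_map_on_def C1_on_def)
    \<comment> \<open>This settles the branch in which \<open>F_metric\<close> takes its default
      value 0.\<close>
    then have "0 \<le> c"
      unfolding c_def
      by (metis divide_nonneg_nonneg frechet_derivative_works has_derivative_bounded_linear onorm_pos_le zero_le_one)
    moreover have "ereal (1 / 2) * (SUP u\<in>F_class \<Omega> x. ereal (sqrt (trace_on \<Lambda> (Hess u x)))) \<le> ereal c"
    proof -
      have "(SUP u\<in>F_class \<Omega> x. ereal (sqrt (trace_on \<Lambda> (Hess u x)))) \<le> ereal (2 * c)"
      proof (rule SUP_least)
        fix u assume "u \<in> F_class \<Omega> x"
        from trace_Hess_le[OF assms(2) this f \<Lambda>]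
        show "ereal (sqrt (trace_on \<Lambda> (Hess u x))) \<le> ereal (2 * c)"
          by (simp add: c_def)
      qed
      then have "ereal (1 / 2) * (SUP u\<in>F_class \<Omega> x. ereal (sqrt (trace_on \<Lambda> (Hess u x))))
          \<le> ereal (1 / 2) * ereal (2 * c)"
        by (intro ereal_mult_left_mono) auto
      then show ?thesis by simp
    qed
    ultimately show "F_metric \<Omega> x \<Lambda> \<le> m"
      unfolding F_metric_def m c_def[symmetric] by simp
  qed
qed

end
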